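(* Let $\mathcal{C}\subseteq\mathbb{R}^n$ be a non-decomposable full-dimensional pointed polyhedral cone with extreme rays $R_1,\dots,R_p$, given by generators $v_i$ with $R_i=\mathbb{R}_+v_i$. Then for a given permutation $\sigma\in\mathrm{Sym}(p)$, whether $\sigma\in\mathrm{Proj}(\mathcal{C})$ can be decided in $O(p^3n)$ time (arithmetic operations).
   Context: A polyhedral cone is the set of vectors satisfying finitely many homogeneous linear inequalities; it is assumed full-dimensional and containing no nontrivial linear subspace, hence generated by its extreme rays. It is decomposable if $\mathbb{R}^n=V_1\oplus V_2$ for nonzero subspaces $V_1,V_2$ such that every extreme ray lies in $V_1$ or in $V_2$; otherwise non-decomposable. $\mathrm{Proj}(\mathcal{C})$ is the group of permutations $\sigma\in\mathrm{Sym}(p)$ for which there exists $A\in\mathrm{GL}_n(\mathbb{R})$ with $A\mathcal{C}=\mathcal{C}$ and $AR_i=R_{\sigma(i)}$ for all $i$. *)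

theory Defs
  imports
    "Jordan_Normal_Form.VS_Connect"
    "HOL-Combinatorics.Permutations"
begin

section \<open>Polyhedral cones\<close>

text \<open>The dimension \<open>n\<close> has to be quantified inside the statement (one algorithm serves all
  dimensions), so \<open>\<real>\<^sup>n\<close> is rendered as \<^term>\<open>carrier_vec n :: real vec set\<close>.\<close>

definition polyhedral_cone :: "nat \<Rightarrow> real vec set \<Rightarrow> bool" where
  "polyhedral_cone n C \<longleftrightarrow>
    (\<exists>F. finite F \<and> F \<subseteq> carrier_vec n \<and>
         C = {x \<in> carrier_vec n. \<forall>a\<in>F. 0 \<le> a \<bullet> x})"

abbreviation lin_subspace :: "nat \<Rightarrow> real vec set \<Rightarrow> bool" where
  "lin_subspace n V \<equiv> VectorSpace.subspace class_ring V (module_vec TYPE(real) n)"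

definition full_dimensional :: "nat \<Rightarrow> real vec set \<Rightarrow> bool" where
  "full_dimensional n C \<longleftrightarrow>
    LinearCombinations.module.span class_ring (module_vec TYPE(real) n) C = carrier_vec n"

definition pointed :: "nat \<Rightarrow> real vec set \<Rightarrow> bool" where
  "pointed n C \<longleftrightarrow> (\<forall>V. lin_subspace n V \<and> V \<subseteq> C \<longrightarrow> V = {0\<^sub>v n})"

definition ray :: "real vec \<Rightarrow> real vec set" where
  "ray v = {c \<cdot>\<^sub>v v | c. 0 \<le> c}"

definition extreme_ray :: "nat \<Rightarrow> real vec set \<Rightarrow> real vec set \<Rightarrow> bool" where
  "extreme_ray n C R \<longleftrightarrow>
    (\<exists>v\<in>C. v \<noteq> 0\<^sub>v n \<and> R = ray v) \<and>
    (\<forall>x\<in>C. \<forall>y\<in>C. x + y \<in> R \<longrightarrow> x \<in> R \<and> y \<in> R)"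

definition direct_sum_decomp :: "nat \<Rightarrow> real vec set \<Rightarrow> real vec set \<Rightarrow> bool" where
  "direct_sum_decomp n V W \<longleftrightarrow>
    lin_subspace n V \<and> lin_subspace n W \<and> V \<inter> W = {0\<^sub>v n} \<and>
    (\<forall>x\<in>carrier_vec n. \<exists>v\<in>V. \<exists>w\<in>W. x = v + w)"

definition decomposable :: "nat \<Rightarrow> real vec set \<Rightarrow> bool" where
  "decomposable n C \<longleftrightarrow>
    (\<exists>V W. direct_sum_decomp n V W \<and> V \<noteq> {0\<^sub>v n} \<and> W \<noteq> {0\<^sub>v n} \<and>
           (\<forall>R. extreme_ray n C R \<longrightarrow> R \<subseteq> V \<or> R \<subseteq> W))"

definition Proj :: "nat \<Rightarrow> real vec set \<Rightarrow> nat \<Rightarrow> (nat \<Rightarrow> real vec set) \<Rightarrow> (nat \<Rightarrow> nat) set" where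
  "Proj n C p R =
    {\<sigma>. \<sigma> permutes {..<p} \<and>
         (\<exists>A\<in>carrier_mat n n. invertible_mat A \<and>
            (\<lambda>x. A *\<^sub>v x) ` C = C \<and>
            (\<forall>i<p. (\<lambda>x. A *\<^sub>v x) ` R i = R (\<sigma> i)))}"


section \<open>A unit-cost real RAM\<close>

text \<open>Running time is measured for programs of a while language over a real RAM. The memory
  consists of natural number variables, natural number arrays and two-dimensional real arrays.
  Real numbers admit only exact field operations and comparisons: there is no rounding and no
  conversion between reals and naturals, and real constants are integers. Naturals serve as
  counters and indices and admit only addition, truncated subtraction and comparison.

  Each constant, each memory access, each arithmetic operation, each comparison, each
  Boolean connective and each executed command costs one unit, so the time of a run bounds
  its number of arithmetic operations. Division by zero yields zero, which a machine with partial
  division simulates by one additional test.\<close>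

type_synonym vname = string

record state =
  ivar :: "vname \<Rightarrow> nat"
  iarr :: "vname \<Rightarrow> nat \<Rightarrow> nat"
  rarr :: "vname \<Rightarrow> nat \<Rightarrow> nat \<Rightarrow> real"

datatype iexp = IConst nat | IVar vname | IArr vname iexp | IAdd iexp iexp | ISub iexp iexp

datatype rexp = RConst int | RArr vname iexp iexp
  | RAdd rexp rexp | RSub rexp rexp | RMul rexp rexp | RDiv rexp rexp

datatype bexp = ILess iexp iexp | IEq iexp iexp | RLess rexp rexp | REq rexp rexp
  | Not bexp | And bexp bexp

datatype com = Skip
  | IVarAssign vname iexp
  | IArrAssign vname iexp iexp
  | RArrAssign vname iexp iexp rexp
  | Seq com com
  | If bexp com com
  | While bexp com

primrec ival :: "iexp \<Rightarrow> state \<Rightarrow> nat" where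
  "ival (IConst k) s = k"
| "ival (IVar x) s = ivar s x"
| "ival (IArr a e) s = iarr s a (ival e s)"
| "ival (IAdd e f) s = ival e s + ival f s"
| "ival (ISub e f) s = ival e s - ival f s"

primrec rval :: "rexp \<Rightarrow> state \<Rightarrow> real" where
  "rval (RConst k) s = of_int k"
| "rval (RArr a e f) s = rarr s a (ival e s) (ival f s)"
| "rval (RAdd e f) s = rval e s + rval f s"
| "rval (RSub e f) s = rval e s - rval f s"
| "rval (RMul e f) s = rval e s * rval f s"
| "rval (RDiv e f) s = rval e s / rval f s"

primrec bval :: "bexp \<Rightarrow> state \<Rightarrow> bool" where
  "bval (ILess e f) s = (ival e s < ival f s)"
| "bval (IEq e f) s = (ival e s = ival f s)"
| "bval (RLess e f) s = (rval e s < rval f s)"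
| "bval (REq e f) s = (rval e s = rval f s)"
| "bval (Not b) s = (\<not> bval b s)"
| "bval (And b c) s = (bval b s \<and> bval c s)"

primrec icost :: "iexp \<Rightarrow> nat" where
  "icost (IConst k) = 1"
| "icost (IVar x) = 1"
| "icost (IArr a e) = 1 + icost e"
| "icost (IAdd e f) = 1 + icost e + icost f"
| "icost (ISub e f) = 1 + icost e + icost f"

primrec rcost :: "rexp \<Rightarrow> nat" where
  "rcost (RConst k) = 1"
| "rcost (RArr a e f) = 1 + icost e + icost f"
| "rcost (RAdd e f) = 1 + rcost e + rcost f"
| "rcost (RSub e f) = 1 + rcost e + rcost f"
| "rcost (RMul e f) = 1 + rcost e + rcost f"
| "rcost (RDiv e f) = 1 + rcost e + rcost f"

primrec bcost :: "bexp \<Rightarrow> nat" where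
  "bcost (ILess e f) = 1 + icost e + icost f"
| "bcost (IEq e f) = 1 + icost e + icost f"
| "bcost (RLess e f) = 1 + rcost e + rcost f"
| "bcost (REq e f) = 1 + rcost e + rcost f"
| "bcost (Not b) = 1 + bcost b"
| "bcost (And b c) = 1 + bcost b + bcost c"

text \<open>\<open>exec c s t s'\<close>: started in state \<open>s\<close>, the program \<open>c\<close> halts in state \<open>s'\<close> after \<open>t\<close> units
  of time.\<close>

inductive exec :: "com \<Rightarrow> state \<Rightarrow> nat \<Rightarrow> state \<Rightarrow> bool" where
  Skip: "exec Skip s 1 s"
| IVarAssign:
    "exec (IVarAssign x e) s (1 + icost e) (s\<lparr>ivar := (ivar s)(x := ival e s)\<rparr>)"
| IArrAssign:
    "exec (IArrAssign a e f) s (1 + icost e + icost f)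
       (s\<lparr>iarr := (iarr s)(a := (iarr s a)(ival e s := ival f s))\<rparr>)"
| RArrAssign:
    "exec (RArrAssign a e f r) s (1 + icost e + icost f + rcost r)
       (s\<lparr>rarr := (rarr s)(a := (rarr s a)(ival e s :=
            (rarr s a (ival e s))(ival f s := rval r s)))\<rparr>)"
| Seq: "exec c s t s' \<Longrightarrow> exec d s' u s'' \<Longrightarrow> exec (Seq c d) s (1 + t + u) s''"
| IfTrue: "bval b s \<Longrightarrow> exec c s t s' \<Longrightarrow> exec (If b c d) s (1 + bcost b + t) s'"
| IfFalse: "\<not> bval b s \<Longrightarrow> exec d s t s' \<Longrightarrow> exec (If b c d) s (1 + bcost b + t) s'"
| WhileFalse: "\<not> bval b s \<Longrightarrow> exec (While b c) s (1 + bcost b) s"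
| WhileTrue: "bval b s \<Longrightarrow> exec c s t s' \<Longrightarrow> exec (While b c) s' u s'' \<Longrightarrow>
    exec (While b c) s (1 + bcost b + t + u) s''"

inductive_cases exec_SkipE: "exec Skip s t s'"
inductive_cases exec_IVarAssignE: "exec (IVarAssign x e) s t s'"
inductive_cases exec_IArrAssignE: "exec (IArrAssign a e f) s t s'"
inductive_cases exec_RArrAssignE: "exec (RArrAssign a e f r) s t s'"
inductive_cases exec_SeqE: "exec (Seq c d) s t s'"
inductive_cases exec_IfE: "exec (If b c d) s t s'"
inductive_cases exec_WhileE: "exec (While b c) s t s'"

lemma exec_deterministic: "exec c s t s' \<Longrightarrow> exec c s u s'' \<Longrightarrow> u = t \<and> s'' = s'"
proof (induction arbitrary: u s'' rule: exec.induct)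
  case (Skip s)
  then show ?case by (auto elim: exec_SkipE)
next
  case (IVarAssign x e s)
  then show ?case by (auto elim: exec_IVarAssignE)
next
  case (IArrAssign a e f s)
  then show ?case by (auto elim: exec_IArrAssignE)
next
  case (RArrAssign a e f r s)
  then show ?case by (auto elim: exec_RArrAssignE)
next
  case (Seq c s t s1 d t' s2)
  from Seq.prems show ?case
    by (rule exec_SeqE) (auto dest!: Seq.IH)
next
  case (IfTrue b s c t s1 d)
  from IfTrue.prems show ?case
    by (rule exec_IfE) (use IfTrue.hyps(1) in \<open>auto dest!: IfTrue.IH\<close>)+
next
  case (IfFalse b s d t s1 c)
  from IfFalse.prems show ?case
    by (rule exec_IfE) (use IfFalse.hyps(1) in \<open>auto dest!: IfFalse.IH\<close>)+
next
  case (WhileFalse b s c)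
  from WhileFalse.prems show ?case
    by (rule exec_WhileE) (use WhileFalse.hyps(1) in auto)
next
  case (WhileTrue b s c t s1 t' s2)
  from WhileTrue.prems show ?case
    by (rule exec_WhileE) (use WhileTrue.hyps(1) in \<open>auto dest!: WhileTrue.IH\<close>)+
qed

text \<open>All memory not occupied by the input \<open>n\<close>, \<open>p\<close>, \<open>v\<close>, \<open>\<sigma>\<close> is initially zero.\<close>

definition input_state :: "nat \<Rightarrow> nat \<Rightarrow> (nat \<Rightarrow> real vec) \<Rightarrow> (nat \<Rightarrow> nat) \<Rightarrow> state" where
  "input_state n p v \<sigma> =
    \<lparr> ivar = (\<lambda>_. 0)(''n'' := n, ''p'' := p),
      iarr = (\<lambda>_ _. 0)(''sigma'' := (\<lambda>i. if i < p then \<sigma> i else 0)),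
      rarr = (\<lambda>_ _ _. 0)(''v'' := (\<lambda>i j. if i < p \<and> j < n then v i $ j else 0)) \<rparr>"

text \<open>The answer of a halted run is the value of the variable \<open>result\<close>: 1 for yes, 0 for no.\<close>

definition answers_within :: "com \<Rightarrow> state \<Rightarrow> nat \<Rightarrow> bool \<Rightarrow> bool" where
  "answers_within prog s T b \<longleftrightarrow>
    (\<exists>t s'. exec prog s t s' \<and> t \<le> T \<and> ivar s' ''result'' = (if b then 1 else 0))"

end

theory Submission
  imports Defs
begin

text \<open>
  A permutation \<open>\<sigma>\<close> belongs to \<open>Proj\<close> iff there are weights \<open>\<mu>\<^sub>i > 0\<close> such that every linear relation
  \<open>\<Sum> c\<^sub>i v\<^sub>i = 0\<close> entails \<open>\<Sum> c\<^sub>i \<mu>\<^sub>i v\<^bsub>\<sigma> i\<^esub> = 0\<close>: this makes \<open>v\<^sub>i \<mapsto> \<mu>\<^sub>i v\<^bsub>\<sigma> i\<^esub>\<close> extend to a linear map, which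
  preserves the cone because a pointed cone is generated by its extreme rays. The condition is a
  system of at most \<open>p n\<close> linear equations in the \<open>p\<close> unknowns \<open>\<mu>\<close>. If it has a positive solution \<open>\<mu>\<close>,
  any other solution \<open>\<nu>\<close> is a multiple of it, since the level sets of \<open>\<nu>\<^sub>i / \<mu>\<^sub>i\<close> would otherwise
  decompose the cone. So it suffices to compute any spanning set of the solution space and to look
  for a member whose entries all have the same strict sign.

  Spanning sets are kept as the \<open>p\<close> rows of a \<open>p \<times> p\<close> array, starting from the unit vectors;
  intersecting with one more hyperplane costs \<open>O(p\<^sup>2)\<close>. The same procedure first computes the relations of
  the \<open>v\<^sub>i\<close>, at cost \<open>O(p\<^sup>2 n)\<close>, and then the weights, at cost \<open>O(p\<^sup>3 n)\<close>.
\<close>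

section \<open>Linear combinations and cones\<close>

text \<open>Defined by coordinates, so that vector identities reduce to identities of finite sums of
  reals and the result always has dimension \<open>n\<close>.\<close>

definition lcomb :: "nat \<Rightarrow> nat set \<Rightarrow> (nat \<Rightarrow> real) \<Rightarrow> (nat \<Rightarrow> real vec) \<Rightarrow> real vec" where
  "lcomb n J c f = vec n (\<lambda>k. \<Sum>i\<in>J. c i * f i $ k)"

lemma lcomb_carrier [simp]: "lcomb n J c f \<in> carrier_vec n"
  by (simp add: lcomb_def)

lemma dim_lcomb [simp]: "dim_vec (lcomb n J c f) = n"
  by (simp add: lcomb_def)

lemma lcomb_index [simp]: "k < n \<Longrightarrow> lcomb n J c f $ k = (\<Sum>i\<in>J. c i * f i $ k)"
  by (simp add: lcomb_def)

lemma lcomb_eq_0_iff: "lcomb n J c f = 0\<^sub>v n \<longleftrightarrow> (\<forall>k<n. (\<Sum>i\<in>J. c i * f i $ k) = 0)"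
  by (auto simp: vec_eq_iff)

lemma lcomb_cong:
  "(\<And>i. i \<in> J \<Longrightarrow> c i = d i) \<Longrightarrow> (\<And>i. i \<in> J \<Longrightarrow> f i = g i) \<Longrightarrow> lcomb n J c f = lcomb n J d g"
  by (auto simp: lcomb_def intro!: sum.cong)

lemma lcomb_add: "lcomb n J (\<lambda>i. c i + d i) f = lcomb n J c f + lcomb n J d f"
  by (rule eq_vecI) (simp_all add: sum.distrib distrib_right)

lemma lcomb_diff: "lcomb n J (\<lambda>i. c i - d i) f = lcomb n J c f - lcomb n J d f"
  by (rule eq_vecI) (simp_all add: sum_subtractf left_diff_distrib)

lemma lcomb_scale: "lcomb n J (\<lambda>i. a * c i) f = a \<cdot>\<^sub>v lcomb n J c f"
  by (rule eq_vecI) (simp_all add: sum_distrib_left mult.assoc)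

lemma lcomb_zero [simp]: "lcomb n J (\<lambda>i. 0) f = 0\<^sub>v n"
  by (rule eq_vecI) simp_all

lemma lcomb_delta:
  assumes "finite J" "i \<in> J" "f i \<in> carrier_vec n"
  shows "lcomb n J (\<lambda>j. if j = i then a else 0) f = a \<cdot>\<^sub>v f i"
proof (rule eq_vecI)
  fix k assume "k < dim_vec (a \<cdot>\<^sub>v f i)"
  then have k: "k < n" using assms(3) by simp
  have "(\<Sum>j\<in>J. (if j = i then a else 0) * f j $ k) = (\<Sum>j\<in>J. if j = i then a * f j $ k else 0)"
    by (rule sum.cong) auto
  then show "lcomb n J (\<lambda>j. if j = i then a else 0) f $ k = (a \<cdot>\<^sub>v f i) $ k"
    using k assms by simp
qed (use assms in simp)

lemma lcomb_restrict:
  assumes "finite J" "I \<subseteq> J"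
  shows "lcomb n J (\<lambda>i. if i \<in> I then c i else 0) f = lcomb n I c f"
proof -
  have "(\<Sum>i\<in>J. (if i \<in> I then c i else 0) * f i $ k) = (\<Sum>i\<in>I. c i * f i $ k)" for k
    by (rule sum.mono_neutral_cong_right) (use assms in auto)
  then show ?thesis by (simp add: lcomb_def)
qed

lemma lcomb_permute:
  assumes "\<sigma> permutes J"
  shows "lcomb n J (\<lambda>i. c (\<sigma> i)) (\<lambda>i. f (\<sigma> i)) = lcomb n J c f"
proof -
  have "(\<Sum>i\<in>J. c (\<sigma> i) * f (\<sigma> i) $ k) = (\<Sum>i\<in>J. c i * f i $ k)" for k
    using sum.permute[OF assms, of "\<lambda>i. c i * f i $ k"] by (simp add: o_def)
  then show ?thesis by (simp add: lcomb_def)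
qed

lemma lcomb_smult:
  assumes "\<And>i. i \<in> J \<Longrightarrow> f i \<in> carrier_vec n"
  shows "lcomb n J c (\<lambda>i. a i \<cdot>\<^sub>v f i) = lcomb n J (\<lambda>i. c i * a i) f"
proof (rule eq_vecI)
  fix k assume "k < dim_vec (lcomb n J (\<lambda>i. c i * a i) f)"
  then have k: "k < n" by simp
  have "(a i \<cdot>\<^sub>v f i) $ k = a i * f i $ k" if "i \<in> J" for i
    using assms[OF that] k by auto
  then show "lcomb n J c (\<lambda>i. a i \<cdot>\<^sub>v f i) $ k = lcomb n J (\<lambda>i. c i * a i) f $ k"
    using k by (simp add: mult.assoc cong: sum.cong)
qed simp

lemma mult_mat_lcomb:
  assumes A: "A \<in> carrier_mat n n" and f: "\<And>i. i \<in> J \<Longrightarrow> f i \<in> carrier_vec n"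
  shows "A *\<^sub>v lcomb n J c f = lcomb n J c (\<lambda>i. A *\<^sub>v f i)"
proof (rule eq_vecI)
  fix k assume "k < dim_vec (lcomb n J c (\<lambda>i. A *\<^sub>v f i))"
  then have k: "k < n" by simp
  have "(A *\<^sub>v lcomb n J c f) $ k = (\<Sum>l<n. A $$ (k,l) * (\<Sum>i\<in>J. c i * f i $ l))"
    using A k by (auto simp: scalar_prod_def lessThan_atLeast0 intro!: sum.cong)
  also have "\<dots> = (\<Sum>i\<in>J. c i * (\<Sum>l<n. A $$ (k,l) * f i $ l))"
    unfolding sum_distrib_left by (subst sum.swap) (simp add: mult.left_commute)
  also have "\<dots> = (\<Sum>i\<in>J. c i * (A *\<^sub>v f i) $ k)"
  proof (rule sum.cong[OF refl])
    fix i assume "i \<in> J"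
    then have "dim_vec (f i) = n" using f by auto
    then show "c i * (\<Sum>l<n. A $$ (k,l) * f i $ l) = c i * (A *\<^sub>v f i) $ k"
      using A k by (simp add: scalar_prod_def lessThan_atLeast0)
  qed
  finally show "(A *\<^sub>v lcomb n J c f) $ k = lcomb n J c (\<lambda>i. A *\<^sub>v f i) $ k"
    using k by simp
qed (use A in simp)

section \<open>Subspaces and matrices obtained from linear combinations\<close>

lemma lin_subspace_lcombs: "lin_subspace n (range (\<lambda>c. lcomb n J c f))"
proof -
  have "submodule class_ring (range (\<lambda>c. lcomb n J c f)) (module_vec TYPE(real) n)"
  proof (rule submodule.intro, goal_cases)
    case 1
    show ?case by (rule vec_module)
  next
    case 2
    show ?case by (auto simp: module_vec_simps)
  next
    case (3 v w)
    then show ?case by (auto simp: module_vec_simps lcomb_add[symmetric])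
  next
    case 4
    show ?case unfolding module_vec_simps by (rule range_eqI[of _ _ "\<lambda>i. 0"]) simp
  next
    case (5 c v)
    then show ?case by (auto simp: module_vec_simps lcomb_scale[symmetric])
  qed
  then show ?thesis using vec_vs by (simp add: subspace_def)
qed

text \<open>Applied to the cone, this turns full-dimensionality into the statement that the ray
  generators span.\<close>

lemma span_le_lcombs:
  assumes "C \<subseteq> range (\<lambda>c. lcomb n J c f)"
  shows "LinearCombinations.module.span class_ring (module_vec TYPE(real) n) C
    \<subseteq> range (\<lambda>c. lcomb n J c f)"
  using module.span_is_subset[OF vec_module assms] lin_subspace_lcombs[of n J f]
  by (simp add: subspace_def)

text \<open>Sending \<open>f i\<close> to \<open>w i\<close> is well defined on combinations because
  relations are respected. Column \<open>k\<close> of the matrix arises by expanding the unit vector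
  \<open>k\<close> in the \<open>f i\<close> and replacing these by the \<open>w i\<close>.\<close>

lemma matrix_of_relations:
  assumes sp: "\<And>x. x \<in> carrier_vec n \<Longrightarrow> \<exists>c. x = lcomb n {..<p} c f"
    and f: "\<And>i. i < p \<Longrightarrow> f i \<in> carrier_vec n" and w: "\<And>i. i < p \<Longrightarrow> w i \<in> carrier_vec n"
    and rel: "\<And>c. lcomb n {..<p} c f = 0\<^sub>v n \<Longrightarrow> lcomb n {..<p} c w = 0\<^sub>v n"
  obtains A where "A \<in> carrier_mat n n" "\<And>i. i < p \<Longrightarrow> A *\<^sub>v f i = w i"
proof -
  have "\<forall>k. \<exists>c. unit_vec n k = lcomb n {..<p} c f" using sp by simp
  then obtain a where a: "\<And>k. unit_vec n k = lcomb n {..<p} (a k) f" by metis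
  define A where "A = mat n n (\<lambda>(r,k). \<Sum>j<p. a k j * w j $ r)"
  have A: "A \<in> carrier_mat n n" by (simp add: A_def)
  have "A *\<^sub>v f i = w i" if i: "i < p" for i
  proof -
    \<comment> \<open>Expanding \<open>f i\<close> in unit vectors, and each of these by
      \<open>a\<close>, gives a second coefficient family for \<open>f i\<close> beside the trivial
      one.\<close>
    define c where "c j = (\<Sum>k<n. f i $ k * a k j)" for j
    have c: "(\<Sum>j<p. c j * g j $ l) = (\<Sum>k<n. f i $ k * (\<Sum>j<p. a k j * g j $ l))"
      for g :: "nat \<Rightarrow> real vec" and l
      unfolding c_def sum_distrib_left sum_distrib_right
      by (subst sum.swap) (simp add: mult.assoc)
    have "lcomb n {..<p} c f = f i"
    proof (rule eq_vecI)
      fix l assume "l < dim_vec (f i)"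
      then have l: "l < n" using f[OF i] by simp
      have "(\<Sum>k<n. f i $ k * (\<Sum>j<p. a k j * f j $ l)) = (\<Sum>k<n. f i $ k * unit_vec n k $ l)"
        using l by (simp add: a)
      also have "\<dots> = (\<Sum>k<n. if k = l then f i $ k else 0)"
        by (rule sum.cong) (use l in \<open>auto simp: unit_vec_def\<close>)
      finally show "lcomb n {..<p} c f $ l = f i $ l" using l by (simp add: c)
    qed (use f[OF i] in simp)
    \<comment> \<open>The two representations of \<open>f i\<close> differ by a relation, which
      \<open>rel\<close> transfers to \<open>w\<close>.\<close>
    then have "lcomb n {..<p} (\<lambda>j. c j - (if j = i then 1 else 0)) f = 0\<^sub>v n"
      using i f[OF i] by (simp add: lcomb_diff lcomb_delta)
    from rel[OF this] have "lcomb n {..<p} c w - w i = 0\<^sub>v n"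
      using i w[OF i] by (simp add: lcomb_diff lcomb_delta)
    then have cw: "lcomb n {..<p} c w = w i"
      using w[OF i] by (auto simp: vec_eq_iff)
    show ?thesis
    proof (rule eq_vecI)
      fix l assume "l < dim_vec (w i)"
      then have l: "l < n" using w[OF i] by simp
      have "(A *\<^sub>v f i) $ l = (\<Sum>k<n. f i $ k * (\<Sum>j<p. a k j * w j $ l))"
        using l f[OF i] by (auto simp: A_def scalar_prod_def lessThan_atLeast0 intro!: sum.cong)
      also have "\<dots> = lcomb n {..<p} c w $ l" using l by (simp add: c)
      finally show "(A *\<^sub>v f i) $ l = w i $ l" by (simp add: cw)
    qed (use A w[OF i] in simp)
  qed
  with A that show ?thesis by blast
qed

text \<open>Preimages of the unit vectors are the columns of a right inverse, and for square
  matrices a right inverse is also a left inverse.\<close>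

lemma invertible_mat_of_spanning_image:
  assumes A: "A \<in> carrier_mat n n"
    and f: "\<And>i. i < p \<Longrightarrow> f i \<in> carrier_vec n"
    and sp: "\<And>x. x \<in> carrier_vec n \<Longrightarrow> \<exists>c. x = lcomb n {..<p} c (\<lambda>i. A *\<^sub>v f i)"
  shows "invertible_mat A"
proof -
  have "\<forall>k. \<exists>c. unit_vec n k = lcomb n {..<p} c (\<lambda>i. A *\<^sub>v f i)" using sp by simp
  then obtain b where b: "\<And>k. unit_vec n k = lcomb n {..<p} (b k) (\<lambda>i. A *\<^sub>v f i)" by metis
  define B where "B = mat n n (\<lambda>(r,k). lcomb n {..<p} (b k) f $ r)"
  have B: "B \<in> carrier_mat n n" by (simp add: B_def)
  have "A * B = 1\<^sub>m n"
  proof (rule eq_matI)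
    fix r k assume "r < dim_row (1\<^sub>m n :: real mat)" "k < dim_col (1\<^sub>m n :: real mat)"
    then have rk: "r < n" "k < n" by auto
    have "col B k = lcomb n {..<p} (b k) f"
      by (rule eq_vecI) (use rk in \<open>auto simp: B_def\<close>)
    then have "(A * B) $$ (r,k) = (A *\<^sub>v lcomb n {..<p} (b k) f) $ r"
      using A B rk by simp
    also have "\<dots> = unit_vec n k $ r"
      using A f by (subst mult_mat_lcomb) (auto simp: b)
    finally show "(A * B) $$ (r,k) = 1\<^sub>m n $$ (r,k)" using rk by (simp add: unit_vec_def)
  qed (use A B in auto)
  moreover from this have "B * A = 1\<^sub>m n" by (rule mat_mult_left_right_inverse[OF A B])
  ultimately show ?thesis
    using A B by (auto simp: invertible_mat_def inverts_mat_def)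
qed

lemma invertible_mat_inj:
  assumes A: "A \<in> carrier_mat n n" and inv: "invertible_mat A"
    and x: "x \<in> carrier_vec n" and Ax: "A *\<^sub>v x = 0\<^sub>v n"
  shows "x = (0\<^sub>v n :: real vec)"
proof -
  obtain B where AB: "inverts_mat A B" and BA: "inverts_mat B A"
    using inv by (auto simp: invertible_mat_def)
  \<comment> \<open>\<open>invertible_mat\<close> does not fix the shape of the inverse; it is read
    off the dimensions of the two identity matrices.\<close>
  have "dim_col (A * B) = dim_col (1\<^sub>m n :: real mat)" "dim_col (B * A) = dim_col (1\<^sub>m (dim_row B) :: real mat)"
    using AB BA A by (auto simp: inverts_mat_def)
  then have B: "B \<in> carrier_mat n n" using A by auto
  have "x = (B * A) *\<^sub>v x" using BA B x by (simp add: inverts_mat_def)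
  also have "\<dots> = B *\<^sub>v (A *\<^sub>v x)" using A B x by simp
  also have "\<dots> = 0\<^sub>v n" unfolding Ax by (rule eq_vecI) (use B in auto)
  finally show ?thesis .
qed

section \<open>Rays and the generation of pointed cones\<close>

lemma mem_ray: "v \<in> ray v"
  unfolding ray_def by (rule CollectI, rule exI[of _ 1]) simp

lemma ray_scale:
  assumes "0 < a" shows "ray (a \<cdot>\<^sub>v v) = ray v"
proof -
  have "c \<cdot>\<^sub>v v = (c / a) \<cdot>\<^sub>v (a \<cdot>\<^sub>v v)" for c
    using assms by (simp add: smult_smult_assoc)
  then have "c \<cdot>\<^sub>v v \<in> ray (a \<cdot>\<^sub>v v)" if "0 \<le> c" for c
    using assms that unfolding ray_def by (metis (mono_tags, lifting) CollectI divide_nonneg_pos)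
  moreover have "c \<cdot>\<^sub>v (a \<cdot>\<^sub>v v) \<in> ray v" if "0 \<le> c" for c
    using assms that unfolding ray_def by (auto simp: smult_smult_assoc intro!: exI[of _ "c * a"])
  ultimately show ?thesis by (auto simp: ray_def)
qed

text \<open>Pointedness speaks of subspaces; the multiples of \<open>y\<close> form one, written as
  combinations over the index set \<open>{0}\<close>.\<close>

lemma pointed_no_line:
  assumes pt: "pointed n C" and y: "y \<in> carrier_vec n"
    and line: "\<And>a. a \<cdot>\<^sub>v y \<in> C"
  shows "y = 0\<^sub>v n"
proof -
  have l: "lcomb n {0} c (\<lambda>_. y) = c 0 \<cdot>\<^sub>v y" for c
    by (rule eq_vecI) (use y in auto)
  have "range (\<lambda>c. lcomb n {0} c (\<lambda>_. y)) = {0\<^sub>v n}"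
    using pt lin_subspace_lcombs[of n "{0}" "\<lambda>_. y"] line unfolding pointed_def
    by (auto simp: l)
  moreover have "y \<in> range (\<lambda>c. lcomb n {0} c (\<lambda>_. y))"
    by (rule range_eqI[of _ _ "\<lambda>_. 1"]) (simp add: l)
  ultimately show ?thesis by blast
qed

text \<open>By induction on the number of constraints that are not tight at \<open>x\<close>: if \<open>x\<close> is not on an extreme
  ray, it is a sum of two elements of the cone at which fewer constraints are not tight.\<close>

lemma pointed_cone_generated:
  assumes F: "finite F" "F \<subseteq> carrier_vec n" and C: "C = {x \<in> carrier_vec n. \<forall>a\<in>F. 0 \<le> a \<bullet> x}"
    and pt: "pointed n C"
    and v: "\<And>i. i < p \<Longrightarrow> v i \<in> carrier_vec n"
    and ext: "\<And>S. extreme_ray n C S \<Longrightarrow> \<exists>i<p. S = ray (v i)"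
    and x: "x \<in> C"
  shows "\<exists>c. (\<forall>i. 0 \<le> c i) \<and> x = lcomb n {..<p} c v"
proof -
  define T where "T x = {a\<in>F. 0 < a \<bullet> x}" for x
  have finT: "finite (T x)" for x using F by (simp add: T_def)
  have Cc: "x \<in> carrier_vec n" if "x \<in> C" for x using that C by simp
  have Fc: "a \<in> carrier_vec n" if "a \<in> F" for a using that F by auto
  have Cnn: "0 \<le> a \<bullet> x" if "x \<in> C" "a \<in> F" for x a using that C by simp
  have sp: "a \<bullet> (x - t \<cdot>\<^sub>v y) = a \<bullet> x - t * (a \<bullet> y)" if "a \<in> F" "x \<in> C" "y \<in> C" for a x y t
    using Cc[OF that(2)] Cc[OF that(3)] Fc[OF that(1)] by (simp add: scalar_prod_minus_distrib[of _ n])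
  \<comment> \<open>If every constraint is tight at \<open>y\<close>, it is tight at all real
    multiples of \<open>y\<close>, so these all lie in the cone and pointedness applies.\<close>
  have zero: "y = 0\<^sub>v n" if y: "y \<in> C" and Ty: "T y = {}" for y
  proof (rule pointed_no_line[OF pt Cc[OF y]])
    have "a \<bullet> y = 0" if "a \<in> F" for a
      using that Ty Cnn[OF y that] by (force simp: T_def)
    then show "a \<cdot>\<^sub>v y \<in> C" for a
      using Cc[OF y] Fc by (simp add: C)
  qed
  \<comment> \<open>Move from \<open>x\<close> in direction \<open>-y\<close> until a first
    constraint of \<open>T y\<close> becomes tight. Constraints already tight at \<open>x\<close>
    stay tight.\<close>
  have shrink: "\<exists>t\<ge>0. x - t \<cdot>\<^sub>v y \<in> C \<and> T (x - t \<cdot>\<^sub>v y) \<subseteq> T x \<and> (\<exists>a\<in>T y. a \<notin> T (x - t \<cdot>\<^sub>v y))"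
    if x: "x \<in> C" and y: "y \<in> C" and Ty: "T y \<noteq> {}" for x y
  proof -
    \<comment> \<open>Ratio test: only constraints with \<open>a \<bullet> y > 0\<close> decrease
      along the way.\<close>
    define t where "t = Min ((\<lambda>a. (a \<bullet> x) / (a \<bullet> y)) ` T y)"
    have "t \<in> (\<lambda>a. (a \<bullet> x) / (a \<bullet> y)) ` T y"
      unfolding t_def by (rule Min_in) (use finT Ty in auto)
    then obtain b where b: "b \<in> T y" "t = (b \<bullet> x) / (b \<bullet> y)" by auto
    have t: "0 \<le> t" using b Cnn[OF x, of b] by (auto simp: T_def)
    have le: "t * (a \<bullet> y) \<le> a \<bullet> x" if a: "a \<in> F" for a
    proof (cases "a \<in> T y")
      case True
      then have "t \<le> (a \<bullet> x) / (a \<bullet> y)" unfolding t_def by (intro Min_le) (use finT in auto)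
      with True show ?thesis by (simp add: T_def field_simps)
    next
      case False
      then have "a \<bullet> y = 0" using Cnn[OF y a] a by (force simp: T_def)
      then show ?thesis using Cnn[OF x a] by simp
    qed
    have 1: "x - t \<cdot>\<^sub>v y \<in> C" 
    proof -
      have "x - t \<cdot>\<^sub>v y \<in> carrier_vec n" using Cc[OF x] Cc[OF y] by simp
      moreover have "0 \<le> a \<bullet> (x - t \<cdot>\<^sub>v y)" if "a \<in> F" for a
        using le[OF that] sp[OF that x y] by simp
      ultimately show ?thesis by (simp add: C)
    qed
    have 2: "T (x - t \<cdot>\<^sub>v y) \<subseteq> T x"
    proof
      fix a assume a: "a \<in> T (x - t \<cdot>\<^sub>v y)"
      then have aF: "a \<in> F" by (simp add: T_def)
      have "0 < a \<bullet> x - t * (a \<bullet> y)" using a sp[OF aF x y] by (simp add: T_def)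
      moreover have "0 \<le> t * (a \<bullet> y)" using t Cnn[OF y aF] by simp
      ultimately show "a \<in> T x" using aF by (simp add: T_def)
    qed
    have 3: "b \<notin> T (x - t \<cdot>\<^sub>v y)"
      using b sp[OF _ x y, of b t] by (auto simp: T_def)
    show ?thesis using t 1 2 3 b(1) by blast
  qed
  show ?thesis using x
  proof (induction "card (T x)" arbitrary: x rule: less_induct)
    case less
    note x = less.prems
    have IH: "\<exists>c. (\<forall>i. 0 \<le> c i) \<and> y = lcomb n {..<p} c v" if "y \<in> C" "T y \<subset> T x" for y
      using less.hyps[OF psubset_card_mono[OF finT that(2)] that(1)] .
    consider "x = 0\<^sub>v n" | "extreme_ray n C (ray x)" | "x \<noteq> 0\<^sub>v n" "\<not> extreme_ray n C (ray x)" by blast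
    then show ?case
    proof cases
      case 1
      then show ?thesis by (intro exI[of _ "\<lambda>_. 0"]) simp
    next
      case 2
      from ext[OF 2] obtain i where i: "i < p" "ray x = ray (v i)" by blast
      then have "x \<in> ray (v i)" using mem_ray by blast
      then obtain a where a: "0 \<le> a" "x = a \<cdot>\<^sub>v v i" by (auto simp: ray_def)
      then show ?thesis using i v
        by (intro exI[of _ "\<lambda>j. if j = i then a else 0"]) (simp add: lcomb_delta)
    next
      case 3
      then obtain y' z' where "y' \<in> C" "z' \<in> C" "y' + z' \<in> ray x" "y' \<notin> ray x \<or> z' \<notin> ray x"
        using x unfolding extreme_ray_def by blast
      \<comment> \<open>By commutativity, the summand off the ray may be taken to be the first
        one.\<close>
      moreover then have "y' + z' = z' + y'" using Cc by (intro comm_add_vec[of _ n]) auto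
      ultimately obtain y z where yz: "y \<in> C" "z \<in> C" "y + z \<in> ray x" "y \<notin> ray x"
        by metis
      then obtain c where c: "0 \<le> c" "y + z = c \<cdot>\<^sub>v x" by (auto simp: ray_def)
      \<comment> \<open>A constraint tight at \<open>x\<close> is tight at \<open>y + z\<close>,
        hence at both summands, where it is nonnegative.\<close>
      have Ty: "T y \<subseteq> T x"
      proof
        fix a assume a: "a \<in> T y"
        then have aF: "a \<in> F" by (simp add: T_def)
        have "a \<bullet> y + a \<bullet> z = c * (a \<bullet> x)"
          using c(2) Cc x yz Fc[OF aF] by (simp add: scalar_prod_add_distrib[of _ n, symmetric])
        moreover have "0 < a \<bullet> y" using a by (simp add: T_def)
        ultimately have "0 < c * (a \<bullet> x)" using Cnn[OF yz(2) aF] by simp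
        then show "a \<in> T x" using c(1) aF by (auto simp: T_def zero_less_mult_iff)
      qed
      have Tx: "T x \<noteq> {}" using zero[OF x] 3(1) by blast
      \<comment> \<open>\<open>T y\<close> may still equal \<open>T x\<close>, so a multiple of
        \<open>x\<close> is first removed from \<open>y\<close>. The constraint that becomes tight
        lies in \<open>T x\<close>, which makes the inclusion strict.\<close>
      from shrink[OF yz(1) x Tx] obtain s b where s: "0 \<le> s" "y - s \<cdot>\<^sub>v x \<in> C"
        "T (y - s \<cdot>\<^sub>v x) \<subseteq> T y" "b \<in> T x" "b \<notin> T (y - s \<cdot>\<^sub>v x)" by blast
      define w where "w = y - s \<cdot>\<^sub>v x"
      have w: "w \<in> C" "T w \<subset> T x" using s Ty by (auto simp: w_def)
      have "w \<noteq> 0\<^sub>v n"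
      proof
        assume "w = 0\<^sub>v n"
        then have "y = s \<cdot>\<^sub>v x" using Cc[OF x] Cc[OF yz(1)] by (auto simp: w_def vec_eq_iff)
        then show False using yz(4) s(1) by (auto simp: ray_def)
      qed
      then have "T w \<noteq> {}" using zero[OF w(1)] by blast
      \<comment> \<open>Removing a multiple of \<open>w\<close> from \<open>x\<close> makes a
        constraint of \<open>T w\<close>, hence of \<open>T x\<close>, tight. So the induction
        hypothesis applies both to \<open>w\<close> and to the remainder of
        \<open>x\<close>.\<close>
      from shrink[OF x w(1) this] obtain t a where t: "0 \<le> t" "x - t \<cdot>\<^sub>v w \<in> C"
        "T (x - t \<cdot>\<^sub>v w) \<subseteq> T x" "a \<in> T w" "a \<notin> T (x - t \<cdot>\<^sub>v w)" by blast
      then have "T (x - t \<cdot>\<^sub>v w) \<subset> T x" using w by blast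
      from IH[OF t(2) this] obtain c1 where c1: "\<forall>i. 0 \<le> c1 i" "x - t \<cdot>\<^sub>v w = lcomb n {..<p} c1 v"
        by blast
      from IH[OF w] obtain c2 where c2: "\<forall>i. 0 \<le> c2 i" "w = lcomb n {..<p} c2 v" by blast
      have "x = (x - t \<cdot>\<^sub>v w) + t \<cdot>\<^sub>v w"
        using Cc[OF x] Cc[OF w(1)] by (auto simp: vec_eq_iff)
      also have "\<dots> = lcomb n {..<p} (\<lambda>i. c1 i + t * c2 i) v"
        by (simp add: lcomb_add lcomb_scale c1(2)[symmetric] c2(2)[symmetric])
      finally show ?thesis using c1(1) c2(1) t(1) by (intro exI[of _ "\<lambda>i. c1 i + t * c2 i"]) simp
    qed
  qed
qed

section \<open>A non-decomposable cone, a permutation of its rays, and weights along it\<close>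

locale nondecomposable_cone =
  fixes n p :: nat and C :: "real vec set" and R :: "nat \<Rightarrow> real vec set"
    and v :: "nat \<Rightarrow> real vec" and \<sigma> :: "nat \<Rightarrow> nat"
  assumes n_pos: "n \<ge> 1"
    and polyhedral: "polyhedral_cone n C" and full: "full_dimensional n C" and pointed: "pointed n C"
    and nondecomposable: "\<not> decomposable n C"
    and rays: "bij_betw R {..<p} {S. extreme_ray n C S}"
    and generators: "\<forall>i<p. v i \<in> carrier_vec n \<and> R i = ray (v i)"
    and perm: "\<sigma> permutes {..<p}"
begin

lemma v_carrier: "i < p \<Longrightarrow> v i \<in> carrier_vec n"
  using generators by blast

lemma \<sigma>_less: "i < p \<Longrightarrow> \<sigma> i < p"
  using permutes_in_image[OF perm, of i] by simp

lemma v\<sigma>_carrier: "i < p \<Longrightarrow> v (\<sigma> i) \<in> carrier_vec n"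
  using v_carrier \<sigma>_less by blast

lemma lcomb_v\<sigma>:
  "lcomb n {..<p} c (\<lambda>i. a i \<cdot>\<^sub>v v (\<sigma> i)) = lcomb n {..<p} (\<lambda>i. c i * a i) (\<lambda>i. v (\<sigma> i))"
  by (rule lcomb_smult) (simp add: v\<sigma>_carrier)

lemma mult_mat_v:
  "A \<in> carrier_mat n n \<Longrightarrow> A *\<^sub>v lcomb n {..<p} c v = lcomb n {..<p} c (\<lambda>i. A *\<^sub>v v i)"
  by (rule mult_mat_lcomb) (simp_all add: v_carrier)

lemma R_eq: "i < p \<Longrightarrow> R i = ray (v i)"
  using generators by blast

lemma extreme_rays: "extreme_ray n C S \<longleftrightarrow> (\<exists>i<p. S = ray (v i))"
proof -
  have "extreme_ray n C S \<longleftrightarrow> S \<in> R ` {..<p}"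
    using bij_betw_imp_surj_on[OF rays] by simp
  then show ?thesis using R_eq by auto
qed

lemma cone_closed:
  assumes "\<And>i. 0 \<le> c i" shows "lcomb n {..<p} c v \<in> C"
proof -
  obtain F where F: "F \<subseteq> carrier_vec n" "C = {x \<in> carrier_vec n. \<forall>a\<in>F. 0 \<le> a \<bullet> x}"
    using polyhedral by (auto simp: polyhedral_cone_def)
  have vC: "v i \<in> C" if i: "i < p" for i
  proof -
    \<comment> \<open>\<open>extreme_ray\<close> only provides some generator \<open>u\<close> in
      the cone; \<open>v i\<close> is a nonnegative multiple of it.\<close>
    obtain u where u: "u \<in> C" "ray (v i) = ray u"
      using extreme_rays[of "ray (v i)"] i unfolding extreme_ray_def by auto
    then obtain a where "0 \<le> a" "v i = a \<cdot>\<^sub>v u" using mem_ray[of "v i"] by (auto simp: ray_def)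
    moreover have "b \<bullet> (a \<cdot>\<^sub>v u) = a * (b \<bullet> u)" if "b \<in> F" for b
      using that F u(1) by (intro scalar_prod_smult_distrib[of _ n]) auto
    ultimately show ?thesis using F u(1) by auto
  qed
  have "0 \<le> a \<bullet> lcomb n {..<p} c v" if a: "a \<in> F" for a
  proof -
    have "a \<bullet> lcomb n {..<p} c v = (\<Sum>k<n. a $ k * (\<Sum>i<p. c i * v i $ k))"
      by (simp add: scalar_prod_def lessThan_atLeast0)
    also have "\<dots> = (\<Sum>i<p. c i * (\<Sum>k<n. a $ k * v i $ k))"
      unfolding sum_distrib_left by (subst sum.swap) (simp add: mult.left_commute)
    also have "\<dots> = (\<Sum>i<p. c i * (a \<bullet> v i))"
    proof (rule sum.cong[OF refl])
      fix i assume "i \<in> {..<p}"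
      then have "dim_vec (v i) = n" using v_carrier by auto
      then show "c i * (\<Sum>k<n. a $ k * v i $ k) = c i * (a \<bullet> v i)"
        by (simp add: scalar_prod_def lessThan_atLeast0)
    qed
    also have "\<dots> \<ge> 0" using vC a F assms by (intro sum_nonneg mult_nonneg_nonneg) auto
    finally show ?thesis .
  qed
  then show ?thesis using F by simp
qed

lemma cone_generated:
  assumes "x \<in> C"
  obtains c where "\<And>i. 0 \<le> c i" "x = lcomb n {..<p} c v"
proof -
  obtain F where "finite F" "F \<subseteq> carrier_vec n" "C = {x \<in> carrier_vec n. \<forall>a\<in>F. 0 \<le> a \<bullet> x}"
    using polyhedral by (auto simp: polyhedral_cone_def)
  from pointed_cone_generated[OF this pointed, of p v x] v_carrier extreme_rays assms that
  show ?thesis by blast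
qed

lemma v_spans:
  assumes "x \<in> carrier_vec n" shows "\<exists>c. x = lcomb n {..<p} c v"
proof -
  have "C \<subseteq> range (\<lambda>c. lcomb n {..<p} c v)" using cone_generated by blast
  from span_le_lcombs[OF this] full assms show ?thesis by (auto simp: full_dimensional_def)
qed

text \<open>The empty family spans only zero, while \<open>n \<ge> 1\<close>. This makes index 0
  available as a reference for ratios and signs of weights, and lets loops over \<open>p\<close>
  absorb their constant overhead.\<close>

lemma p_pos: "p \<ge> 1"
proof (rule ccontr)
  assume "\<not> p \<ge> 1"
  then have p: "p = 0" by simp
  obtain c where "unit_vec n 0 = lcomb n {..<p} c v" using v_spans by fastforce
  then have "unit_vec n 0 $ 0 = lcomb n {..<p} c v $ 0" by simp
  then show False using n_pos p by simp
qed

lemma v_nonzero: assumes "i < p" shows "v i \<noteq> 0\<^sub>v n"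
proof
  assume v: "v i = 0\<^sub>v n"
  obtain u where u: "u \<noteq> 0\<^sub>v n" "ray (v i) = ray u"
    using extreme_rays[of "ray (v i)"] assms unfolding extreme_ray_def by auto
  then have "u \<in> ray (0\<^sub>v n)" using mem_ray[of u] v by simp
  then have "u = 0\<^sub>v n" by (auto simp: ray_def)
  with u show False by simp
qed

text \<open>Expresses that \<open>v i \<mapsto> \<mu> i \<cdot>\<^sub>v v (\<sigma> i)\<close>
  respects all relations and so extends linearly. Positivity is kept out, so that the condition is
  linear in \<open>\<mu>\<close>.\<close>

definition scaling :: "(nat \<Rightarrow> real) \<Rightarrow> bool" where
  "scaling \<mu> \<longleftrightarrow> (\<forall>c. lcomb n {..<p} c v = 0\<^sub>v n \<longrightarrow>
     lcomb n {..<p} (\<lambda>i. c i * \<mu> i) (\<lambda>i. v (\<sigma> i)) = 0\<^sub>v n)"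

lemma scaling_matrix:
  assumes "scaling \<mu>"
  obtains A where "A \<in> carrier_mat n n" "\<And>i. i < p \<Longrightarrow> A *\<^sub>v v i = \<mu> i \<cdot>\<^sub>v v (\<sigma> i)"
proof (rule matrix_of_relations[of n p v "\<lambda>i. \<mu> i \<cdot>\<^sub>v v (\<sigma> i)"])
  show "lcomb n {..<p} c (\<lambda>i. \<mu> i \<cdot>\<^sub>v v (\<sigma> i)) = 0\<^sub>v n" if "lcomb n {..<p} c v = 0\<^sub>v n" for c
    using assms that by (simp add: scaling_def lcomb_v\<sigma>)
qed (use v_spans v_carrier v\<sigma>_carrier that in auto)

text \<open>Positive weights can be divided out after reindexing by \<open>\<sigma>\<close>, so the
  images of the \<open>v i\<close> still span; the map is onto and hence invertible.\<close>

lemma positive_scaling_matrix: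
  assumes "scaling \<mu>" and pos: "\<And>i. i < p \<Longrightarrow> 0 < \<mu> i"
  obtains A where "A \<in> carrier_mat n n" "invertible_mat A" "\<And>i. i < p \<Longrightarrow> A *\<^sub>v v i = \<mu> i \<cdot>\<^sub>v v (\<sigma> i)"
proof -
  obtain A where A: "A \<in> carrier_mat n n" and Av: "\<And>i. i < p \<Longrightarrow> A *\<^sub>v v i = \<mu> i \<cdot>\<^sub>v v (\<sigma> i)"
    using scaling_matrix[OF assms(1)] by blast
  have "\<exists>c. x = lcomb n {..<p} c (\<lambda>i. A *\<^sub>v v i)" if "x \<in> carrier_vec n" for x
  proof -
    obtain c where "x = lcomb n {..<p} c v" using v_spans \<open>x \<in> carrier_vec n\<close> by blast
    also have "\<dots> = lcomb n {..<p} (\<lambda>i. c (\<sigma> i)) (\<lambda>i. v (\<sigma> i))"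
      using lcomb_permute[OF perm] by metis
    also have "\<dots> = lcomb n {..<p} (\<lambda>i. c (\<sigma> i) / \<mu> i * \<mu> i) (\<lambda>i. v (\<sigma> i))"
      using pos by (intro lcomb_cong) (auto simp: less_imp_neq[symmetric])
    also have "\<dots> = lcomb n {..<p} (\<lambda>i. c (\<sigma> i) / \<mu> i) (\<lambda>i. \<mu> i \<cdot>\<^sub>v v (\<sigma> i))"
      by (rule lcomb_v\<sigma>[symmetric])
    also have "\<dots> = lcomb n {..<p} (\<lambda>i. c (\<sigma> i) / \<mu> i) (\<lambda>i. A *\<^sub>v v i)"
      using Av by (intro lcomb_cong) auto
    finally show ?thesis by blast
  qed
  then have "invertible_mat A"
    using invertible_mat_of_spanning_image[OF A, of p v] v_carrier by blast
  with A Av that show ?thesis by blast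
qed

text \<open>A matrix witnessing membership in \<open>Proj\<close> multiplies generators by factors
  that are positive because it is injective, and it maps relations to relations. Conversely,
  positive weights give an invertible matrix, which maps the cone onto itself because the cone
  consists of the nonnegative combinations of the \<open>v i\<close>.\<close>

lemma Proj_iff_scaling:
  "\<sigma> \<in> Proj n C p R \<longleftrightarrow> (\<exists>\<mu>. (\<forall>i<p. 0 < \<mu> i) \<and> scaling \<mu>)"
proof
  assume "\<sigma> \<in> Proj n C p R"
  then obtain A where A: "A \<in> carrier_mat n n" "invertible_mat A"
    and AR: "\<And>i. i < p \<Longrightarrow> (\<lambda>x. A *\<^sub>v x) ` R i = R (\<sigma> i)"
    by (auto simp: Proj_def)
  have "\<exists>a>0. A *\<^sub>v v i = a \<cdot>\<^sub>v v (\<sigma> i)" if i: "i < p" for i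
  proof -
    have "A *\<^sub>v v i \<in> ray (v (\<sigma> i))"
      using AR[OF i] R_eq[OF i] R_eq[OF \<sigma>_less[OF i]] mem_ray[of "v i"] by blast
    then obtain a where a: "0 \<le> a" "A *\<^sub>v v i = a \<cdot>\<^sub>v v (\<sigma> i)" by (auto simp: ray_def)
    have "a \<noteq> 0"
    proof
      assume "a = 0"
      then have "A *\<^sub>v v i = 0\<^sub>v n" using a v\<sigma>_carrier[OF i] by auto
      then show False using invertible_mat_inj[OF A v_carrier[OF i]] v_nonzero[OF i] by blast
    qed
    with a show ?thesis by (intro exI[of _ a]) auto
  qed
  then obtain \<mu> where \<mu>: "\<And>i. i < p \<Longrightarrow> 0 < \<mu> i" "\<And>i. i < p \<Longrightarrow> A *\<^sub>v v i = \<mu> i \<cdot>\<^sub>v v (\<sigma> i)"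
    by metis
  have "scaling \<mu>" unfolding scaling_def
  proof (intro allI impI)
    fix c assume c: "lcomb n {..<p} c v = 0\<^sub>v n"
    have "lcomb n {..<p} (\<lambda>i. c i * \<mu> i) (\<lambda>i. v (\<sigma> i)) = lcomb n {..<p} c (\<lambda>i. \<mu> i \<cdot>\<^sub>v v (\<sigma> i))"
      by (rule lcomb_v\<sigma>[symmetric])
    also have "\<dots> = lcomb n {..<p} c (\<lambda>i. A *\<^sub>v v i)"
      using \<mu>(2) by (intro lcomb_cong) auto
    also have "\<dots> = A *\<^sub>v lcomb n {..<p} c v"
      using A(1) by (simp add: mult_mat_v)
    also have "\<dots> = 0\<^sub>v n" unfolding c by (rule eq_vecI) (use A in auto)
    finally show "lcomb n {..<p} (\<lambda>i. c i * \<mu> i) (\<lambda>i. v (\<sigma> i)) = 0\<^sub>v n" .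
  qed
  with \<mu>(1) show "\<exists>\<mu>. (\<forall>i<p. 0 < \<mu> i) \<and> scaling \<mu>" by blast
next
  assume "\<exists>\<mu>. (\<forall>i<p. 0 < \<mu> i) \<and> scaling \<mu>"
  then obtain \<mu> where pos: "\<And>i. i < p \<Longrightarrow> 0 < \<mu> i" and "scaling \<mu>" by blast
  then obtain A where A: "A \<in> carrier_mat n n" "invertible_mat A"
    and Av: "\<And>i. i < p \<Longrightarrow> A *\<^sub>v v i = \<mu> i \<cdot>\<^sub>v v (\<sigma> i)"
    using positive_scaling_matrix by blast
  have Al: "A *\<^sub>v lcomb n {..<p} c v = lcomb n {..<p} (\<lambda>i. c i * \<mu> i) (\<lambda>i. v (\<sigma> i))" for c
  proof -
    have "A *\<^sub>v lcomb n {..<p} c v = lcomb n {..<p} c (\<lambda>i. A *\<^sub>v v i)"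
      using A(1) by (simp add: mult_mat_v)
    also have "\<dots> = lcomb n {..<p} c (\<lambda>i. \<mu> i \<cdot>\<^sub>v v (\<sigma> i))"
      using Av by (intro lcomb_cong) auto
    also have "\<dots> = lcomb n {..<p} (\<lambda>i. c i * \<mu> i) (\<lambda>i. v (\<sigma> i))"
      by (rule lcomb_v\<sigma>)
    finally show ?thesis .
  qed
  have "(\<lambda>x. A *\<^sub>v x) ` R i = R (\<sigma> i)" if i: "i < p" for i
  proof -
    have "(\<lambda>x. A *\<^sub>v x) ` ray (v i) = ray (A *\<^sub>v v i)"
      using mult_mat_vec[OF A(1) v_carrier[OF i]] unfolding ray_def by (auto simp: image_iff) metis
    also have "\<dots> = ray (v (\<sigma> i))" using Av[OF i] ray_scale[OF pos[OF i]] by simp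
    finally show ?thesis using R_eq[OF i] R_eq[OF \<sigma>_less[OF i]] by simp
  qed
  moreover have "(\<lambda>x. A *\<^sub>v x) ` C = C"
  proof
    show "(\<lambda>x. A *\<^sub>v x) ` C \<subseteq> C"
    proof clarify
      fix x assume "x \<in> C"
      then obtain c where c: "\<And>i. 0 \<le> c i" "x = lcomb n {..<p} c v" using cone_generated by blast
      \<comment> \<open>The coefficient \<open>c k * \<mu> k\<close> belongs to
        \<open>v (\<sigma> k)\<close>, hence the inverse of \<open>\<sigma>\<close>. The default 0
        is there because \<open>cone_closed\<close> asks for nonnegativity at every index, while
        \<open>\<mu>\<close> is known to be positive only below \<open>p\<close>.\<close>
      define d where "d i = (let k = inv_into UNIV \<sigma> i in if k < p then c k * \<mu> k else 0)" for i
      have "A *\<^sub>v x = lcomb n {..<p} (\<lambda>i. d (\<sigma> i)) (\<lambda>i. v (\<sigma> i))"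
        unfolding c(2) Al by (rule lcomb_cong) (use permutes_inverses[OF perm] in \<open>auto simp: d_def Let_def\<close>)
      also have "\<dots> = lcomb n {..<p} d v" by (rule lcomb_permute[OF perm])
      also have "\<dots> \<in> C"
        by (rule cone_closed) (use c(1) pos in \<open>auto simp: d_def Let_def less_imp_le\<close>)
      finally show "A *\<^sub>v x \<in> C" .
    qed
    show "C \<subseteq> (\<lambda>x. A *\<^sub>v x) ` C"
    proof
      fix y assume "y \<in> C"
      then obtain d where d: "\<And>i. 0 \<le> d i" "y = lcomb n {..<p} d v" using cone_generated by blast
      \<comment> \<open>Coefficients of a preimage: undo the permutation and divide by the weights,
        again with 0 from \<open>p\<close> on.\<close>
      define c where "c i = (if i < p then d (\<sigma> i) / \<mu> i else 0)" for i
      have "y = lcomb n {..<p} (\<lambda>i. d (\<sigma> i)) (\<lambda>i. v (\<sigma> i))"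
        unfolding d(2) by (rule lcomb_permute[OF perm, symmetric])
      also have "\<dots> = lcomb n {..<p} (\<lambda>i. c i * \<mu> i) (\<lambda>i. v (\<sigma> i))"
        by (rule lcomb_cong) (use pos in \<open>auto simp: c_def less_imp_neq[symmetric]\<close>)
      also have "\<dots> = A *\<^sub>v lcomb n {..<p} c v" by (rule Al[symmetric])
      finally have "y = A *\<^sub>v lcomb n {..<p} c v" .
      moreover have "lcomb n {..<p} c v \<in> C"
        by (rule cone_closed) (use d(1) pos in \<open>auto simp: c_def less_imp_le\<close>)
      ultimately show "y \<in> (\<lambda>x. A *\<^sub>v x) ` C" by blast
    qed
  qed
  ultimately show "\<sigma> \<in> Proj n C p R" using A perm by (auto simp: Proj_def)
qed

text \<open>If every relation stays a relation when cut down to \<open>I\<close>, the spans of the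
  generators inside and outside \<open>I\<close> meet only in zero. For a proper nonempty
  \<open>I\<close> both spans are nonzero, so they would decompose the cone.\<close>

lemma relations_not_split:
  assumes I: "I \<subseteq> {..<p}" "I \<noteq> {}"
    and rel: "\<And>c. lcomb n {..<p} c v = 0\<^sub>v n \<Longrightarrow> lcomb n I c v = 0\<^sub>v n"
  shows "I = {..<p}"
proof (rule ccontr)
  assume ne: "I \<noteq> {..<p}"
  define J where "J = {..<p} - I"
  define V where "V = range (\<lambda>c. lcomb n I c v)"
  define W where "W = range (\<lambda>c. lcomb n J c v)"
  have fin: "finite I" "finite J" "J \<subseteq> {..<p}" using I finite_subset[of I] by (auto simp: J_def)
  have mem: "a \<cdot>\<^sub>v v i \<in> range (\<lambda>c. lcomb n K c v)" if "K \<subseteq> {..<p}" "i \<in> K" for K i a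
  proof -
    have "finite K" "v i \<in> carrier_vec n" using that finite_subset[of K] v_carrier by auto
    then show ?thesis using lcomb_delta[of K i v n a] that by (metis rangeI)
  qed
  have v1: "v i = 1 \<cdot>\<^sub>v v i" for i by simp
  have nz: "range (\<lambda>c. lcomb n K c v) \<noteq> {0\<^sub>v n}" if K: "K \<subseteq> {..<p}" "K \<noteq> {}" for K
  proof -
    obtain i where i: "i \<in> K" using K by blast
    then have "v i \<in> range (\<lambda>c. lcomb n K c v)" using mem[OF K(1) i, of 1] v1 by simp
    then show ?thesis using v_nonzero[of i] i K by auto
  qed
  have "V \<inter> W = {0\<^sub>v n}"
  proof
    show "V \<inter> W \<subseteq> {0\<^sub>v n}"
    proof
      fix x assume "x \<in> V \<inter> W"
      then obtain c d where c: "x = lcomb n I c v" and d: "x = lcomb n J d v"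
        unfolding V_def W_def by blast
      \<comment> \<open>The difference of the two representations of \<open>x\<close> is a relation
        whose part on \<open>I\<close> is the first representation.\<close>
      define e where "e i = (if i \<in> I then c i else 0) - (if i \<in> J then d i else 0)" for i
      have "lcomb n {..<p} e v = x - x"
        unfolding e_def lcomb_diff using I fin c d by (simp add: lcomb_restrict)
      also have "\<dots> = 0\<^sub>v n" unfolding c by (rule eq_vecI) auto
      finally have "lcomb n I e v = 0\<^sub>v n" by (rule rel)
      moreover have "lcomb n I e v = x"
        unfolding c by (rule lcomb_cong) (auto simp: e_def J_def)
      ultimately show "x \<in> {0\<^sub>v n}" by simp
    qed
    have "0\<^sub>v n \<in> range (\<lambda>c. lcomb n K c v)" for K
      by (rule range_eqI[of _ _ "\<lambda>_. 0"]) simp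
    then show "{0\<^sub>v n} \<subseteq> V \<inter> W" by (simp add: V_def W_def)
  qed
  moreover have "\<exists>y\<in>V. \<exists>z\<in>W. x = y + z" if x: "x \<in> carrier_vec n" for x
  proof -
    obtain c where c: "x = lcomb n {..<p} c v" using v_spans[OF x] by blast
    have "x = lcomb n {..<p} (\<lambda>i. (if i \<in> I then c i else 0) + (if i \<in> J then c i else 0)) v"
      unfolding c by (rule lcomb_cong) (auto simp: J_def)
    also have "\<dots> = lcomb n I c v + lcomb n J c v"
      unfolding lcomb_add using I fin by (simp add: lcomb_restrict)
    finally show ?thesis by (auto simp: V_def W_def)
  qed
  moreover have "lin_subspace n V" "lin_subspace n W"
    unfolding V_def W_def by (rule lin_subspace_lcombs)+
  ultimately have "direct_sum_decomp n V W" by (simp add: direct_sum_decomp_def)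
  moreover have "V \<noteq> {0\<^sub>v n}" "W \<noteq> {0\<^sub>v n}"
    using nz[OF I] nz[OF fin(3)] ne I by (auto simp: V_def W_def J_def)
  moreover have "S \<subseteq> V \<or> S \<subseteq> W" if "extreme_ray n C S" for S
  proof -
    obtain i where i: "i < p" "S = ray (v i)" using \<open>extreme_ray n C S\<close> extreme_rays by blast
    then consider "i \<in> I" | "i \<in> J" by (auto simp: J_def)
    then show ?thesis
      using mem[OF I(1), of i] mem[OF fin(3), of i] unfolding i(2) ray_def V_def W_def
      by cases (auto simp del: rangeI)
  qed
  ultimately have "decomposable n C"
    unfolding decomposable_def by (intro exI[of _ V] exI[of _ W]) auto
  then show False using nondecomposable by blast
qed

text \<open>Multiplying coefficients by the ratio \<open>t = \<nu> / \<mu>\<close> maps relations to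
  relations. So do polynomials in \<open>t\<close>, in particular one that is the indicator of a
  level set of \<open>t\<close>; by \<open>relations_not_split\<close> a nonempty level set is
  everything. The entries of \<open>\<nu>\<close> may have any signs.\<close>

lemma scaling_unique:
  assumes \<mu>: "scaling \<mu>" "\<And>i. i < p \<Longrightarrow> 0 < \<mu> i" and \<nu>: "scaling \<nu>"
  obtains a where "\<And>i. i < p \<Longrightarrow> \<nu> i = a * \<mu> i"
proof -
  define t where "t i = \<nu> i / \<mu> i" for i
  \<comment> \<open>The level set through index 0, nonempty because
    \<open>p \<ge> 1\<close>.\<close>
  define \<tau> where "\<tau> = t 0"
  define I where "I = {i. i < p \<and> t i = \<tau>}"
  obtain A where A: "A \<in> carrier_mat n n" "invertible_mat A"
    and Av: "\<And>i. i < p \<Longrightarrow> A *\<^sub>v v i = \<mu> i \<cdot>\<^sub>v v (\<sigma> i)"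
    using positive_scaling_matrix[OF \<mu>] by blast
  \<comment> \<open>\<open>A\<close> turns the factor \<open>t\<close> into the weights
    \<open>\<nu>\<close>, for which the combination vanishes; \<open>A\<close> is injective.\<close>
  have mult_t: "lcomb n {..<p} (\<lambda>i. c i * t i) v = 0\<^sub>v n" if c: "lcomb n {..<p} c v = 0\<^sub>v n" for c
  proof (rule invertible_mat_inj[OF A lcomb_carrier])
    have "A *\<^sub>v lcomb n {..<p} (\<lambda>i. c i * t i) v
        = lcomb n {..<p} (\<lambda>i. c i * t i) (\<lambda>i. A *\<^sub>v v i)"
      using A(1) by (simp add: mult_mat_v)
    also have "\<dots> = lcomb n {..<p} (\<lambda>i. c i * t i) (\<lambda>i. \<mu> i \<cdot>\<^sub>v v (\<sigma> i))"
      using Av by (intro lcomb_cong) auto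
    also have "\<dots> = lcomb n {..<p} (\<lambda>i. c i * t i * \<mu> i) (\<lambda>i. v (\<sigma> i))"
      by (rule lcomb_v\<sigma>)
    also have "\<dots> = lcomb n {..<p} (\<lambda>i. c i * \<nu> i) (\<lambda>i. v (\<sigma> i))"
      by (rule lcomb_cong) (use \<mu>(2) in \<open>auto simp: t_def less_imp_neq[symmetric]\<close>)
    also have "\<dots> = 0\<^sub>v n" using \<nu> c by (simp add: scaling_def)
    finally show "A *\<^sub>v lcomb n {..<p} (\<lambda>i. c i * t i) v = 0\<^sub>v n" .
  qed
  \<comment> \<open>The relations are closed under multiplication by polynomials in \<open>t\<close>, in particular by the Lagrange
    polynomial which is 1 at \<open>\<tau>\<close> and 0 at the other values of \<open>t\<close>.\<close>
  have mult_prod: "lcomb n {..<p} (\<lambda>i. c i * (\<Prod>s\<in>S. t i - s)) v = 0\<^sub>v n"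
    if "finite S" "lcomb n {..<p} c v = 0\<^sub>v n" for S c
    using that
  proof (induction S arbitrary: c rule: finite_induct)
    case (insert s S)
    have "lcomb n {..<p} (\<lambda>i. c i * t i - s * c i) v = 0\<^sub>v n"
      unfolding lcomb_diff lcomb_scale mult_t[OF insert.prems] insert.prems by (rule eq_vecI) auto
    then have "lcomb n {..<p} (\<lambda>i. c i * (t i - s)) v = 0\<^sub>v n"
      by (simp add: algebra_simps)
    from insert.IH[OF this] show ?case using insert.hyps by (simp add: mult.assoc)
  qed simp
  have "I = {..<p}"
  proof (rule relations_not_split)
    show "I \<subseteq> {..<p}" by (auto simp: I_def)
    have "0 \<in> I" using p_pos by (simp add: I_def \<tau>_def)
    then show "I \<noteq> {}" by blast
    fix c assume c: "lcomb n {..<p} c v = 0\<^sub>v n"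
    define S where "S = t ` {..<p} - {\<tau>}"
    \<comment> \<open>Normalising constant of the Lagrange polynomial, nonzero because
      \<open>\<tau>\<close> is left out of \<open>S\<close>.\<close>
    define \<pi> where "\<pi> = (\<Prod>s\<in>S. \<tau> - s)"
    have S: "finite S" by (simp add: S_def)
    have "\<pi> \<noteq> 0" using S by (auto simp: \<pi>_def S_def)
    have "lcomb n {..<p} (\<lambda>i. 1 / \<pi> * (c i * (\<Prod>s\<in>S. t i - s))) v = 0\<^sub>v n"
      unfolding lcomb_scale mult_prod[OF S c] by (rule eq_vecI) auto
    also have "lcomb n {..<p} (\<lambda>i. 1 / \<pi> * (c i * (\<Prod>s\<in>S. t i - s))) v
        = lcomb n {..<p} (\<lambda>i. if i \<in> I then c i else 0) v"
    proof (rule lcomb_cong)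
      fix i assume i: "i \<in> {..<p}"
      show "1 / \<pi> * (c i * (\<Prod>s\<in>S. t i - s)) = (if i \<in> I then c i else 0)"
      proof (cases "i \<in> I")
        case True
        then show ?thesis using \<open>\<pi> \<noteq> 0\<close> by (simp add: I_def \<pi>_def)
      next
        case False
        then have "t i \<in> S" using i by (auto simp: I_def S_def)
        then have "(\<Prod>s\<in>S. t i - s) = 0" using S by (auto simp: prod_zero_iff)
        then show ?thesis using False by simp
      qed
    qed simp
    also have "\<dots> = lcomb n I c v" by (rule lcomb_restrict) (auto simp: I_def)
    finally show "lcomb n I c v = 0\<^sub>v n" .
  qed
  have "\<nu> i = \<tau> * \<mu> i" if "i < p" for i
  proof -
    have "i \<in> I" using that \<open>I = {..<p}\<close> by simp
    then have "\<nu> i / \<mu> i = \<tau>" by (simp add: I_def t_def)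
    then show ?thesis using \<mu>(2)[OF that] by (simp add: field_simps)
  qed
  with that show ?thesis by blast
qed

end

section \<open>Timed programs\<close>

text \<open>Total correctness with an upper bound on the time. A bound instead of the exact time
  lets branches and iterations of unequal cost be joined; by \<open>exec_deterministic\<close> the
  run is the only one.\<close>

definition runs :: "com \<Rightarrow> state \<Rightarrow> nat \<Rightarrow> (state \<Rightarrow> bool) \<Rightarrow> bool" where
  "runs c s T Q \<longleftrightarrow> (\<exists>t s'. exec c s t s' \<and> t \<le> T \<and> Q s')"

lemma runs_mono: "runs c s T Q \<Longrightarrow> T \<le> T' \<Longrightarrow> (\<And>s'. Q s' \<Longrightarrow> Q' s') \<Longrightarrow> runs c s T' Q'"
  unfolding runs_def by (meson le_trans)

lemma runs_Skip: "Q s \<Longrightarrow> runs Skip s 1 Q"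
  unfolding runs_def using exec.Skip by blast

lemma runs_IVarAssign:
  "Q (s\<lparr>ivar := (ivar s)(x := ival e s)\<rparr>) \<Longrightarrow> runs (IVarAssign x e) s (1 + icost e) Q"
  unfolding runs_def using exec.IVarAssign by blast

lemma runs_RArrAssign:
  "Q (s\<lparr>rarr := (rarr s)(a := (rarr s a)(ival e s := (rarr s a (ival e s))(ival f s := rval r s)))\<rparr>)
    \<Longrightarrow> runs (RArrAssign a e f r) s (1 + icost e + icost f + rcost r) Q"
  unfolding runs_def using exec.RArrAssign by blast

lemma runs_Seq:
  assumes "runs c s T1 P" and "\<And>s'. P s' \<Longrightarrow> runs d s' T2 Q"
  shows "runs (Seq c d) s (1 + T1 + T2) Q"
proof -
  obtain t s' where 1: "exec c s t s'" "t \<le> T1" "P s'" using assms(1) by (auto simp: runs_def)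
  obtain u s'' where 2: "exec d s' u s''" "u \<le> T2" "Q s''"
    using assms(2)[OF 1(3)] by (auto simp: runs_def)
  have "1 + t + u \<le> 1 + T1 + T2" using 1 2 by simp
  then show ?thesis using exec.Seq[OF 1(1) 2(1)] 2(3) unfolding runs_def by blast
qed

lemma runs_If:
  assumes "bval b s \<Longrightarrow> runs c s T Q" "\<not> bval b s \<Longrightarrow> runs d s T Q"
  shows "runs (If b c d) s (1 + bcost b + T) Q"
proof (cases "bval b s")
  case True
  from assms(1)[OF this] obtain t s' where 1: "exec c s t s'" "t \<le> T" "Q s'"
    by (auto simp: runs_def)
  from exec.IfTrue[OF True 1(1)] 1(2,3) show ?thesis
    unfolding runs_def by (meson add_left_mono)
next
  case False
  from assms(2)[OF this] obtain t s' where 1: "exec d s t s'" "t \<le> T" "Q s'"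
    by (auto simp: runs_def)
  from exec.IfFalse[OF False 1(1)] 1(2,3) show ?thesis
    unfolding runs_def by (meson add_left_mono)
qed

section \<open>Frame conditions and counting loops\<close>

primrec writes :: "com \<Rightarrow> vname set" where
  "writes Skip = {}"
| "writes (IVarAssign x e) = {x}"
| "writes (IArrAssign a e f) = {a}"
| "writes (RArrAssign a e f r) = {a}"
| "writes (Seq c d) = writes c \<union> writes d"
| "writes (If b c d) = writes c \<union> writes d"
| "writes (While b c) = writes c"

text \<open>Scalars and arrays may share names, so a name outside \<open>X\<close> protects all
  three kinds of memory.\<close>

definition same_outside :: "vname set \<Rightarrow> state \<Rightarrow> state \<Rightarrow> bool" where
  "same_outside X s s' \<longleftrightarrow>
    (\<forall>x. x \<notin> X \<longrightarrow> ivar s' x = ivar s x \<and> iarr s' x = iarr s x \<and> rarr s' x = rarr s x)"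

lemma same_outsideD:
  assumes "same_outside X s s'" "x \<notin> X"
  shows "ivar s' x = ivar s x" "iarr s' x = iarr s x" "rarr s' x = rarr s x"
  using assms by (auto simp: same_outside_def)

lemma same_outside_mono: "same_outside X s s' \<Longrightarrow> X \<subseteq> Y \<Longrightarrow> same_outside Y s s'"
  by (auto simp: same_outside_def)

lemma same_outside_trans:
  "same_outside X s s' \<Longrightarrow> same_outside Y s' s'' \<Longrightarrow> same_outside (X \<union> Y) s s''"
  by (auto simp: same_outside_def)

lemma exec_same_outside: "exec c s t s' \<Longrightarrow> same_outside (writes c) s s'"
  by (induction rule: exec.induct) (auto simp: same_outside_def)

lemma runs_frame:
  assumes "runs c s T Q" shows "runs c s T (\<lambda>s'. Q s' \<and> same_outside (writes c) s s')"
  using assms exec_same_outside unfolding runs_def by blast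

definition For :: "vname \<Rightarrow> vname \<Rightarrow> com \<Rightarrow> com" where
  "For x y c = Seq (IVarAssign x (IConst 0))
     (While (ILess (IVar x) (IVar y)) (Seq c (IVarAssign x (IAdd (IVar x) (IConst 1)))))"

lemma writes_For [simp]: "writes (For x y c) = insert x (writes c)"
  by (auto simp: For_def)

text \<open>\<open>P k\<close> is the invariant after \<open>k\<close> rounds and must ignore the
  counter (\<open>ins\<close>); facts on unchanged memory come from \<open>same_outside\<close>
  instead. Each round costs 9 beyond the body: 4 for the test, 1 for sequencing, 4 for the
  increment. Initialisation and the last test cost 7 more in all, which \<open>N \<ge> 1\<close>
  allows to charge to the rounds, giving 16.\<close>

lemma runs_For:
  assumes xy: "x \<noteq> y" "x \<notin> writes c" "y \<notin> writes c"
    and N: "ivar s0 y = N" "N \<ge> 1"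
    and init: "P 0 s0"
    and ins: "\<And>k s m. P k s \<Longrightarrow> P k (s\<lparr>ivar := (ivar s)(x := m)\<rparr>)"
    and step: "\<And>k s. k < N \<Longrightarrow> P k s \<Longrightarrow> ivar s x = k \<Longrightarrow>
      same_outside (insert x (writes c)) s0 s \<Longrightarrow> runs c s T (P (Suc k))"
    and post: "\<And>s. P N s \<Longrightarrow> same_outside (insert x (writes c)) s0 s \<Longrightarrow> Q s"
    and time: "N * (T + 16) \<le> T'"
  shows "runs (For x y c) s0 T' Q"
proof -
  let ?b = "ILess (IVar x) (IVar y)" and ?c = "Seq c (IVarAssign x (IAdd (IVar x) (IConst 1)))"
  let ?S = "same_outside (insert x (writes c)) s0"
  have loop: "runs (While ?b ?c) s (4 + m * (T + 9)) (\<lambda>s. P N s \<and> ?S s)"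
    if "P k s" "ivar s x = k" "?S s" "k + m = N" for k m s
    using that
  proof (induction m arbitrary: k s)
    case 0
    have "ivar s y = N" using same_outsideD(1)[OF 0(3), of y] xy N by simp
    then have "\<not> bval ?b s" using 0 by simp
    from exec.WhileFalse[OF this, of ?c] show ?case using 0 unfolding runs_def
      by (intro exI[of _ "1 + bcost ?b"] exI[of _ s]) simp
  next
    case (Suc m)
    have y: "ivar s y = N" using same_outsideD(1)[OF Suc.prems(3), of y] xy N by simp
    then have b: "bval ?b s" using Suc.prems by simp
    have "k < N" using Suc.prems by simp
    from runs_frame[OF step[OF this Suc.prems(1-3)]]
    obtain t s' where t: "exec c s t s'" "t \<le> T" "P (Suc k) s'" "same_outside (writes c) s s'"
      by (auto simp: runs_def)
    let ?s = "s'\<lparr>ivar := (ivar s')(x := Suc k)\<rparr>"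
    have x': "ivar s' x = k" using same_outsideD(1)[OF t(4) xy(2)] Suc.prems by simp
    have e: "exec (IVarAssign x (IAdd (IVar x) (IConst 1))) s' 4 ?s"
      using exec.IVarAssign[of x "IAdd (IVar x) (IConst 1)" s'] x' by (simp add: eval_nat_numeral)
    from exec.Seq[OF t(1) e] have e2: "exec ?c s (1 + t + 4) ?s" .
    have S: "?S ?s" using Suc.prems(3) t(4) by (auto simp: same_outside_def)
    from Suc.IH[of "Suc k" ?s] ins[OF t(3)] S Suc.prems(4)
    obtain u s'' where u: "exec (While ?b ?c) ?s u s''" "u \<le> 4 + m * (T + 9)" "P N s''" "?S s''"
      by (auto simp: runs_def)
    from exec.WhileTrue[OF b e2 u(1)]
    have "exec (While ?b ?c) s (1 + bcost ?b + (1 + t + 4) + u) s''" .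
    moreover have "1 + bcost ?b + (1 + t + 4) + u \<le> 4 + Suc m * (T + 9)"
      using t(2) u(2) by simp
    ultimately show ?case using u(3,4) unfolding runs_def by blast
  qed
  have "runs (For x y c) s0 (1 + (1 + icost (IConst 0)) + (4 + N * (T + 9))) (\<lambda>s. P N s \<and> ?S s)"
    unfolding For_def
  proof (rule runs_Seq[OF runs_IVarAssign])
    show "P 0 (s0\<lparr>ivar := (ivar s0)(x := ival (IConst 0) s0)\<rparr>) \<and>
      ivar (s0\<lparr>ivar := (ivar s0)(x := ival (IConst 0) s0)\<rparr>) x = 0 \<and>
      ?S (s0\<lparr>ivar := (ivar s0)(x := ival (IConst 0) s0)\<rparr>)"
      using ins[OF init] by (auto simp: same_outside_def)
    fix s assume "P 0 s \<and> ivar s x = 0 \<and> ?S s"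
    then show "runs (While ?b ?c) s (4 + N * (T + 9)) (\<lambda>s. P N s \<and> ?S s)"
      using loop[of 0 s N] by simp
  qed
  then show ?thesis
  proof (rule runs_mono)
    have "1 + (1 + icost (IConst 0)) + (4 + N * (T + 9)) \<le> N * (T + 16)"
      using N(2) by (simp add: algebra_simps)
    then show "1 + (1 + icost (IConst 0)) + (4 + N * (T + 9)) \<le> T'" using time by simp
  qed (use post in blast)
qed

definition fill :: "vname \<Rightarrow> rexp \<Rightarrow> com" where
  "fill X r = For ''i'' ''p'' (For ''j'' ''p'' (RArrAssign X (IVar ''i'') (IVar ''j'') r))"

lemma writes_fill [simp]: "writes (fill X r) = {''i'', ''j'', X}"
  by (simp add: fill_def)

text \<open>\<open>val\<close> is required whatever \<open>X\<close> contains, so cells already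
  overwritten cannot influence later ones. The 35 consists of 3 for the assignment and 16 for each
  of the two loops, the outer overhead being estimated by \<open>p * p\<close>.\<close>

lemma runs_fill:
  assumes X: "X \<notin> {''i'', ''j'', ''p''}" and p: "ivar s0 ''p'' = p" "p \<ge> 1"
    and val: "\<And>s a b. a < p \<Longrightarrow> b < p \<Longrightarrow> same_outside {''i'', ''j'', X} s0 s \<Longrightarrow>
      ivar s ''i'' = a \<Longrightarrow> ivar s ''j'' = b \<Longrightarrow> rval r s = g a b"
    and post: "\<And>s. (\<And>a b. a < p \<Longrightarrow> b < p \<Longrightarrow> rarr s X a b = g a b) \<Longrightarrow>
      same_outside {''i'', ''j'', X} s0 s \<Longrightarrow> Q s"
    and time: "p * p * (rcost r + 35) \<le> T"
  shows "runs (fill X r) s0 T Q"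
  unfolding fill_def
proof (rule runs_For[where P = "\<lambda>k s. \<forall>a<k. \<forall>b<p. rarr s X a b = g a b"
      and T = "p * (3 + rcost r + 16)", OF _ _ _ p])
  show "p * (p * (3 + rcost r + 16) + 16) \<le> T"
  proof -
    have "p * (p * (3 + rcost r + 16) + 16) = p * p * (rcost r + 19) + p * 16"
      by (simp add: algebra_simps)
    also have "\<dots> \<le> p * p * (rcost r + 19) + p * p * 16"
      using p by (intro add_left_mono mult_right_mono) simp_all
    also have "\<dots> = p * p * (rcost r + 35)" by (simp add: algebra_simps)
    also note time
    finally show ?thesis .
  qed
next
  fix k s assume k: "k < p" and P: "\<forall>a<k. \<forall>b<p. rarr s X a b = g a b" and i: "ivar s ''i'' = k"
    and S: "same_outside (insert ''i'' (writes (For ''j'' ''p''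
      (RArrAssign X (IVar ''i'') (IVar ''j'') r)))) s0 s"
  have S: "same_outside {''i'', ''j'', X} s0 s" using S by simp
  have p': "ivar s ''p'' = p" using same_outsideD(1)[OF S, of "''p''"] X p by auto
  show "runs (For ''j'' ''p'' (RArrAssign X (IVar ''i'') (IVar ''j'') r)) s
     (p * (3 + rcost r + 16)) (\<lambda>s. \<forall>a<Suc k. \<forall>b<p. rarr s X a b = g a b)"
  proof (rule runs_For[where P = "\<lambda>m s. (\<forall>a<k. \<forall>b<p. rarr s X a b = g a b) \<and>
          (\<forall>b<m. rarr s X k b = g k b)" and T = "3 + rcost r", OF _ _ _ p' p(2)])
    fix m s' assume m: "m < p" and P': "(\<forall>a<k. \<forall>b<p. rarr s' X a b = g a b) \<and>
          (\<forall>b<m. rarr s' X k b = g k b)" and j: "ivar s' ''j'' = m"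
      and S': "same_outside (insert ''j'' (writes (RArrAssign X (IVar ''i'') (IVar ''j'') r))) s s'"
    have i': "ivar s' ''i'' = k" using same_outsideD(1)[OF S', of "''i''"] X i by auto
    have "same_outside {''i'', ''j'', X} s0 s'"
      by (rule same_outside_mono[OF same_outside_trans[OF S S']]) auto
    from val[OF k m this i' j] have v: "rval r s' = g k m" .
    have "runs (RArrAssign X (IVar ''i'') (IVar ''j'') r) s'
       (1 + icost (IVar ''i'') + icost (IVar ''j'') + rcost r)
       (\<lambda>s. (\<forall>a<k. \<forall>b<p. rarr s X a b = g a b) \<and> (\<forall>b<Suc m. rarr s X k b = g k b))"
      by (rule runs_RArrAssign) (use P' i' j v in \<open>auto simp: less_Suc_eq\<close>)
    then show "runs (RArrAssign X (IVar ''i'') (IVar ''j'') r) s' (3 + rcost r)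
       (\<lambda>s. (\<forall>a<k. \<forall>b<p. rarr s X a b = g a b) \<and> (\<forall>b<Suc m. rarr s X k b = g k b))"
      by (rule runs_mono) auto
  qed (use X P in \<open>auto simp: less_Suc_eq\<close>)
qed (use X post in auto)

section \<open>The decision procedure\<close>

abbreviation "Ii \<equiv> IVar ''i''"
abbreviation "Ij \<equiv> IVar ''j''"

text \<open>Evaluates the equation stored in \<open>E\<close> at the rows of \<open>Z\<close>. Real
  arrays are two-dimensional, so the vector of values is kept in column 0 of
  \<open>d\<close>.\<close>

definition dots :: com where
  "dots = For ''i'' ''p'' (Seq (RArrAssign ''d'' Ii (IConst 0) (RConst 0))
     (For ''j'' ''p'' (RArrAssign ''d'' Ii (IConst 0)
        (RAdd (RArr ''d'' Ii (IConst 0)) (RMul (RArr ''E'' Ii Ij) (RArr ''Z'' Ii Ij))))))"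

lemma writes_dots [simp]: "writes dots = {''i'', ''j'', ''d''}"
  by (auto simp: dots_def)

lemma runs_dots:
  assumes p: "ivar s0 ''p'' = p" "p \<ge> 1"
    and post: "\<And>s. (\<And>a. a < p \<Longrightarrow> rarr s ''d'' a 0 = (\<Sum>b<p. rarr s0 ''E'' a b * rarr s0 ''Z'' a b)) \<Longrightarrow>
      same_outside {''i'', ''j'', ''d''} s0 s \<Longrightarrow> Q s"
    and time: "p * p * 60 \<le> T"
  shows "runs dots s0 T Q"
  unfolding dots_def
proof (rule runs_For[where P = "\<lambda>k s. \<forall>a<k. rarr s ''d'' a 0 = (\<Sum>b<p. rarr s0 ''E'' a b * rarr s0 ''Z'' a b)"
      and T = "1 + 4 + p * (14 + 16)", OF _ _ _ p])
  have "p * (1 + 4 + p * (14 + 16) + 16) = p * p * 30 + p * 21"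
    by (simp add: algebra_simps)
  also have "\<dots> \<le> p * p * 30 + p * p * 30"
    using p by (intro add_left_mono mult_le_mono) simp_all
  also have "\<dots> = p * p * 60" by simp
  also note time
  finally show "p * (1 + 4 + p * (14 + 16) + 16) \<le> T" .
next
  fix k s assume k: "k < p"
    and P: "\<forall>a<k. rarr s ''d'' a 0 = (\<Sum>b<p. rarr s0 ''E'' a b * rarr s0 ''Z'' a b)"
    and i: "ivar s ''i'' = k"
    and "same_outside (insert ''i'' (writes (Seq (RArrAssign ''d'' Ii (IConst 0) (RConst 0))
     (For ''j'' ''p'' (RArrAssign ''d'' Ii (IConst 0)
        (RAdd (RArr ''d'' Ii (IConst 0)) (RMul (RArr ''E'' Ii Ij) (RArr ''Z'' Ii Ij)))))))) s0 s"
  then have S: "same_outside {''i'', ''j'', ''d''} s0 s" by (simp add: insert_commute)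
  let ?A = "RArrAssign ''d'' Ii (IConst 0)
        (RAdd (RArr ''d'' Ii (IConst 0)) (RMul (RArr ''E'' Ii Ij) (RArr ''Z'' Ii Ij)))"
  let ?P = "\<lambda>m s'. (\<forall>a<k. rarr s' ''d'' a 0 = (\<Sum>b<p. rarr s0 ''E'' a b * rarr s0 ''Z'' a b)) \<and>
    rarr s' ''d'' k 0 = (\<Sum>b<m. rarr s0 ''E'' k b * rarr s0 ''Z'' k b)"
  show "runs (Seq (RArrAssign ''d'' Ii (IConst 0) (RConst 0)) (For ''j'' ''p'' ?A)) s
     (1 + 4 + p * (14 + 16))
     (\<lambda>s. \<forall>a<Suc k. rarr s ''d'' a 0 = (\<Sum>b<p. rarr s0 ''E'' a b * rarr s0 ''Z'' a b))"
  proof (rule runs_Seq)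
    have "runs (RArrAssign ''d'' Ii (IConst 0) (RConst 0)) s
       (1 + icost Ii + icost (IConst 0) + rcost (RConst 0))
       (\<lambda>s'. ?P 0 s' \<and> same_outside {''d''} s s')"
      by (rule runs_RArrAssign) (use P i in \<open>auto simp: same_outside_def\<close>)
    then show "runs (RArrAssign ''d'' Ii (IConst 0) (RConst 0)) s 4
       (\<lambda>s'. ?P 0 s' \<and> same_outside {''d''} s s')" by (rule runs_mono) auto
    fix s1 assume s1: "?P 0 s1 \<and> same_outside {''d''} s s1"
    have S1: "same_outside {''i'', ''j'', ''d''} s0 s1"
      by (rule same_outside_mono[OF same_outside_trans[OF S]]) (use s1 in auto)
    have i1: "ivar s1 ''i'' = k" using s1 i by (simp add: same_outside_def)
    have p1: "ivar s1 ''p'' = p" using S1 p by (simp add: same_outside_def)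
    show "runs (For ''j'' ''p'' ?A) s1 (p * (14 + 16))
     (\<lambda>s. \<forall>a<Suc k. rarr s ''d'' a 0 = (\<Sum>b<p. rarr s0 ''E'' a b * rarr s0 ''Z'' a b))"
    proof (rule runs_For[where P = ?P and T = "14", OF _ _ _ p1 p(2)])
      fix m s' assume m: "m < p" and P': "?P m s'" and j: "ivar s' ''j'' = m"
        and S': "same_outside (insert ''j'' (writes ?A)) s1 s'"
      have e: "ivar s' ''i'' = k" "rarr s' ''E'' = rarr s0 ''E''" "rarr s' ''Z'' = rarr s0 ''Z''"
        using S' S1 i1 by (auto simp: same_outside_def)
      have "runs ?A s' (1 + icost Ii + icost (IConst 0) + rcost
        (RAdd (RArr ''d'' Ii (IConst 0)) (RMul (RArr ''E'' Ii Ij) (RArr ''Z'' Ii Ij)))) (?P (Suc m))"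
        by (rule runs_RArrAssign) (use P' e j in auto)
      then show "runs ?A s' 14 (?P (Suc m))" by (rule runs_mono) auto
    qed (use s1 in \<open>auto simp: less_Suc_eq\<close>)
  qed
qed (use post in \<open>auto simp: insert_commute\<close>)

text \<open>Finds the last row violating the equation. If there is none, \<open>q\<close> remains 0,
  a valid row when \<open>p \<ge> 1\<close>.\<close>

definition pivot :: com where
  "pivot = Seq (IVarAssign ''q'' (IConst 0))
     (For ''i'' ''p'' (If (REq (RArr ''d'' Ii (IConst 0)) (RConst 0)) Skip (IVarAssign ''q'' Ii)))"

lemma writes_pivot [simp]: "writes pivot = {''i'', ''q''}"
  by (auto simp: pivot_def)

lemma runs_pivot:
  assumes p: "ivar s0 ''p'' = p" "p \<ge> 1"
    and post: "\<And>s. ivar s ''q'' < p \<Longrightarrow>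
      rarr s0 ''d'' (ivar s ''q'') 0 \<noteq> 0 \<or> (\<forall>a<p. rarr s0 ''d'' a 0 = 0) \<Longrightarrow>
      same_outside {''i'', ''q''} s0 s \<Longrightarrow> Q s"
    and time: "p * 30 \<le> T"
  shows "runs pivot s0 T Q"
proof -
  let ?I = "If (REq (RArr ''d'' Ii (IConst 0)) (RConst 0)) Skip (IVarAssign ''q'' Ii)"
  let ?P = "\<lambda>k s. ivar s ''q'' < p \<and>
      (rarr s0 ''d'' (ivar s ''q'') 0 \<noteq> 0 \<or> (\<forall>a<k. rarr s0 ''d'' a 0 = 0))"
  have "runs pivot s0 (1 + 2 + p * (8 + 16)) Q"
    unfolding pivot_def
  proof (rule runs_Seq)
    have "runs (IVarAssign ''q'' (IConst 0)) s0 (1 + icost (IConst 0))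
      (\<lambda>s. ivar s ''q'' = 0 \<and> same_outside {''q''} s0 s)"
      by (rule runs_IVarAssign) (auto simp: same_outside_def)
    then show "runs (IVarAssign ''q'' (IConst 0)) s0 2
      (\<lambda>s. ivar s ''q'' = 0 \<and> same_outside {''q''} s0 s)" by (rule runs_mono) auto
    fix s1 assume s1: "ivar s1 ''q'' = 0 \<and> same_outside {''q''} s0 s1"
    then have p1: "ivar s1 ''p'' = p" using p by (simp add: same_outside_def)
    show "runs (For ''i'' ''p'' ?I) s1 (p * (8 + 16)) Q"
    proof (rule runs_For[where P = ?P and T = "8", OF _ _ _ p1 p(2)])
      fix k s assume k: "k < p" and P: "?P k s" and i: "ivar s ''i'' = k"
        and S: "same_outside (insert ''i'' (writes ?I)) s1 s"
      have d: "rarr s ''d'' = rarr s0 ''d''" using S s1 by (auto simp: same_outside_def)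
      have "runs ?I s (1 + bcost (REq (RArr ''d'' Ii (IConst 0)) (RConst 0)) + 2) (?P (Suc k))"
      proof (rule runs_If)
        assume "bval (REq (RArr ''d'' Ii (IConst 0)) (RConst 0)) s"
        then have "?P (Suc k) s" using P d i by (auto simp: less_Suc_eq)
        from runs_Skip[of "?P (Suc k)", OF this] show "runs Skip s 2 (?P (Suc k))"
          by (rule runs_mono) auto
      next
        assume b: "\<not> bval (REq (RArr ''d'' Ii (IConst 0)) (RConst 0)) s"
        have "runs (IVarAssign ''q'' Ii) s (1 + icost Ii) (?P (Suc k))"
          by (rule runs_IVarAssign) (use b k d i in auto)
        then show "runs (IVarAssign ''q'' Ii) s 2 (?P (Suc k))" by (rule runs_mono) auto
      qed
      then show "runs ?I s 8 (?P (Suc k))" by (rule runs_mono) auto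
    next
      fix s assume P: "?P p s" and S: "same_outside (insert ''i'' (writes ?I)) s1 s"
      have "same_outside {''i'', ''q''} s0 s"
        by (rule same_outside_mono[OF same_outside_trans[OF _ S]]) (use s1 in auto)
      then show "Q s" using P post by blast
    qed (use s1 p in auto)
  qed
  then show ?thesis by (rule runs_mono) (use time p in auto)
qed

text \<open>Row \<open>i\<close> of \<open>E\<close> holds the coefficients of the new equation, the same for each \<open>i\<close>. If no row of \<open>Z\<close>
  violates the equation, all \<open>d i\<close> vanish, and the update leaves \<open>Z\<close> unchanged since \<open>0 / 0 = 0\<close>.\<close>

definition cut_solutions :: com where
  "cut_solutions = Seq dots (Seq pivot
     (Seq (fill ''W'' (RSub (RArr ''Z'' Ii Ij)
             (RMul (RDiv (RArr ''d'' Ii (IConst 0)) (RArr ''d'' (IVar ''q'') (IConst 0)))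
                (RArr ''Z'' (IVar ''q'') Ij))))
          (fill ''Z'' (RArr ''W'' Ii Ij))))"

lemma writes_cut [simp]: "writes cut_solutions = {''i'', ''j'', ''d'', ''q'', ''W'', ''Z''}"
  by (auto simp: cut_solutions_def)

section \<open>Spanning sets of solution spaces\<close>

definition dotp :: "nat \<Rightarrow> (nat \<Rightarrow> real) \<Rightarrow> (nat \<Rightarrow> real) \<Rightarrow> real" where
  "dotp p e x = (\<Sum>j<p. e j * x j)"

text \<open>The rows may be dependent, so their number stays \<open>p\<close> while the space
  shrinks. Functions on all naturals stand for vectors; only entries below \<open>p\<close>
  matter.\<close>

definition spans_solutions :: "nat \<Rightarrow> (nat \<Rightarrow> real) set \<Rightarrow> (nat \<Rightarrow> nat \<Rightarrow> real) \<Rightarrow> bool" where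
  "spans_solutions p M Z \<longleftrightarrow> (\<forall>i<p. \<forall>e\<in>M. dotp p e (Z i) = 0) \<and>
     (\<forall>x. (\<forall>e\<in>M. dotp p e x = 0) \<longrightarrow> (\<exists>c. \<forall>j<p. x j = (\<Sum>i<p. c i * Z i j)))"

text \<open>With a nonzero pivot, each row is projected along row \<open>q\<close> onto the new
  hyperplane. A solution \<open>x\<close> keeps its coefficients \<open>c\<close>: the multiple of
  row \<open>q\<close> subtracted in total is proportional to
  \<open>\<Sum> c i * dotp p e (Z i)\<close>, which is the value of the new equation at
  \<open>x\<close>.\<close>

lemma spans_solutions_cut:
  assumes Z: "spans_solutions p M Z" and q: "q < p"
    and piv: "dotp p e (Z q) \<noteq> 0 \<or> (\<forall>i<p. dotp p e (Z i) = 0)"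
    and Z': "\<And>i j. i < p \<Longrightarrow> j < p \<Longrightarrow> Z' i j = Z i j - dotp p e (Z i) / dotp p e (Z q) * Z q j"
  shows "spans_solutions p (insert e M) Z'"
proof -
  let ?t = "\<lambda>i. dotp p e (Z i) / dotp p e (Z q)"
  have lin: "dotp p f (Z' i) = dotp p f (Z i) - ?t i * dotp p f (Z q)" if i: "i < p" for f i
  proof -
    have "dotp p f (Z' i) = (\<Sum>j<p. f j * Z i j - ?t i * (f j * Z q j))"
      unfolding dotp_def[of p f]
      by (rule sum.cong) (simp_all add: Z'[OF i] right_diff_distrib mult.left_commute)
    then show ?thesis
      unfolding dotp_def[of p f] by (simp only: sum_subtractf sum_distrib_left)
  qed
  have "dotp p f (Z' i) = 0" if "i < p" "f \<in> insert e M" for f i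
    using that q Z piv lin[OF that(1), of f] by (auto simp: spans_solutions_def)
  moreover have "\<exists>c. \<forall>j<p. x j = (\<Sum>i<p. c i * Z' i j)"
    if x: "\<forall>f\<in>insert e M. dotp p f x = 0" for x
  proof -
    obtain c where c: "\<And>j. j < p \<Longrightarrow> x j = (\<Sum>i<p. c i * Z i j)"
      using Z x by (auto simp: spans_solutions_def)
    have "dotp p e x = (\<Sum>j<p. \<Sum>i<p. c i * (e j * Z i j))"
      unfolding dotp_def by (rule sum.cong) (auto simp: c sum_distrib_left algebra_simps)
    also have "\<dots> = (\<Sum>i<p. c i * dotp p e (Z i))"
      unfolding dotp_def sum_distrib_left by (rule sum.swap)
    finally have 0: "(\<Sum>i<p. c i * dotp p e (Z i)) = 0" using x by simp
    have "x j = (\<Sum>i<p. c i * Z' i j)" if j: "j < p" for j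
    proof -
      have "(\<Sum>i<p. c i * Z' i j)
          = (\<Sum>i<p. c i * Z i j - c i * dotp p e (Z i) * (Z q j / dotp p e (Z q)))"
        by (rule sum.cong) (simp_all add: Z'[OF _ j] right_diff_distrib)
      also have "\<dots> = x j"
        unfolding sum_subtractf sum_distrib_right[symmetric] 0 by (simp add: c[OF j])
      finally show ?thesis by simp
    qed
    then show ?thesis by blast
  qed
  ultimately show ?thesis unfolding spans_solutions_def by blast
qed

lemma spans_solutions_cong:
  assumes "\<And>i j. i < p \<Longrightarrow> j < p \<Longrightarrow> Z i j = Z' i j"
  shows "spans_solutions p M Z \<longleftrightarrow> spans_solutions p M Z'"
proof -
  have "dotp p e (Z i) = dotp p e (Z' i)" if "i < p" for e i
    using assms that by (auto simp: dotp_def)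
  moreover have "(\<Sum>i<p. c i * Z i j) = (\<Sum>i<p. c i * Z' i j)" if "j < p" for c j
    using assms that by auto
  ultimately show ?thesis by (simp add: spans_solutions_def)
qed

lemma runs_cut:
  assumes p: "ivar s0 ''p'' = p" "p \<ge> 1"
    and Z: "spans_solutions p M (rarr s0 ''Z'')"
    and E: "\<And>a b. a < p \<Longrightarrow> b < p \<Longrightarrow> rarr s0 ''E'' a b = e b"
    and post: "\<And>s. spans_solutions p (insert e M) (rarr s ''Z'') \<Longrightarrow>
      same_outside (writes cut_solutions) s0 s \<Longrightarrow> Q s"
    and time: "p * p * 200 \<le> T"
  shows "runs cut_solutions s0 T Q"
proof -
  let ?Z = "rarr s0 ''Z''"
  let ?f = "RSub (RArr ''Z'' Ii Ij)
             (RMul (RDiv (RArr ''d'' Ii (IConst 0)) (RArr ''d'' (IVar ''q'') (IConst 0)))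
                (RArr ''Z'' (IVar ''q'') Ij))"
  let ?D = "\<lambda>s. (\<forall>a<p. rarr s ''d'' a 0 = dotp p e (?Z a)) \<and> ivar s ''p'' = p \<and> rarr s ''Z'' = ?Z"
  have "runs cut_solutions s0 (1 + p * p * 60 + (1 + p * 30 + (1 + p * p * 51 + p * p * 38)))
    (\<lambda>s. spans_solutions p (insert e M) (rarr s ''Z''))"
    unfolding cut_solutions_def
  proof (rule runs_Seq[where P = ?D], rule runs_dots[OF p _ order_refl])
    fix s1 assume d: "\<And>a. a < p \<Longrightarrow> rarr s1 ''d'' a 0 = (\<Sum>b<p. rarr s0 ''E'' a b * rarr s0 ''Z'' a b)"
      and S: "same_outside {''i'', ''j'', ''d''} s0 s1"
    have "rarr s1 ''d'' a 0 = dotp p e (?Z a)" if "a < p" for a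
      unfolding d[OF that] dotp_def by (rule sum.cong) (use E that in auto)
    with S show "?D s1"
      using p by (auto simp: same_outside_def)
  next
    fix s1 :: state assume s1: "?D s1"
    let ?P = "\<lambda>s. ivar s ''q'' < p \<and> (\<forall>a<p. rarr s ''d'' a 0 = dotp p e (?Z a)) \<and>
      (dotp p e (?Z (ivar s ''q'')) \<noteq> 0 \<or> (\<forall>a<p. dotp p e (?Z a) = 0)) \<and>
      ivar s ''p'' = p \<and> rarr s ''Z'' = ?Z"
    show "runs (Seq pivot (Seq (fill ''W'' ?f) (fill ''Z'' (RArr ''W'' Ii Ij)))) s1
      (1 + p * 30 + (1 + p * p * 51 + p * p * 38))
      (\<lambda>s. spans_solutions p (insert e M) (rarr s ''Z''))"
    proof (rule runs_Seq[where P = ?P], rule runs_pivot[OF _ p(2) _ order_refl])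
      show "ivar s1 ''p'' = p" using s1 by simp
      fix s2 assume "ivar s2 ''q'' < p"
        "rarr s1 ''d'' (ivar s2 ''q'') 0 \<noteq> 0 \<or> (\<forall>a<p. rarr s1 ''d'' a 0 = 0)"
        "same_outside {''i'', ''q''} s1 s2"
      then show "?P s2" using s1 by (auto simp: same_outside_def)
    next
      fix s2 :: state assume s2: "?P s2"
      \<comment> \<open>\<open>W\<close> collects the new rows while the old ones are still being
        read: row \<open>q\<close> enters every update and is itself updated.\<close>
      let ?g = "\<lambda>a b. ?Z a b - dotp p e (?Z a) / dotp p e (?Z (ivar s2 ''q'')) * ?Z (ivar s2 ''q'') b"
      let ?R = "\<lambda>s. (\<forall>a<p. \<forall>b<p. rarr s ''W'' a b = ?g a b) \<and> ivar s ''p'' = p"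
      show "runs (Seq (fill ''W'' ?f) (fill ''Z'' (RArr ''W'' Ii Ij))) s2
        (1 + p * p * 51 + p * p * 38) (\<lambda>s. spans_solutions p (insert e M) (rarr s ''Z''))"
      proof (rule runs_Seq[where P = ?R])
        show "runs (fill ''W'' ?f) s2 (p * p * 51) ?R"
        proof (rule runs_fill[where g = ?g, OF _ _ p(2)])
          fix s a b assume ab: "a < p" "b < p" and S: "same_outside {''i'', ''j'', ''W''} s2 s"
            and ij: "ivar s ''i'' = a" "ivar s ''j'' = b"
          have "rarr s ''Z'' = ?Z" "ivar s ''q'' = ivar s2 ''q''" "rarr s ''d'' = rarr s2 ''d''"
            using S s2 by (auto simp: same_outside_def)
          then show "rval ?f s = ?g a b" using ij s2 ab by simp
        next
          fix s assume "\<And>a b. a < p \<Longrightarrow> b < p \<Longrightarrow> rarr s ''W'' a b = ?g a b"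
            "same_outside {''i'', ''j'', ''W''} s2 s"
          then show "?R s" using s2 by (auto simp: same_outside_def)
        qed (use s2 in \<open>auto\<close>)
        fix s3 :: state assume s3: "?R s3"
        show "runs (fill ''Z'' (RArr ''W'' Ii Ij)) s3 (p * p * 38)
          (\<lambda>s. spans_solutions p (insert e M) (rarr s ''Z''))"
        proof (rule runs_fill[where g = ?g, OF _ _ p(2)])
          fix s a b assume ab: "a < p" "b < p" and S: "same_outside {''i'', ''j'', ''Z''} s3 s"
            and ij: "ivar s ''i'' = a" "ivar s ''j'' = b"
          have "rarr s ''W'' = rarr s3 ''W''" using S by (auto simp: same_outside_def)
          then show "rval (RArr ''W'' Ii Ij) s = ?g a b" using ij s3 ab by simp
        next
          fix s assume "\<And>a b. a < p \<Longrightarrow> b < p \<Longrightarrow> rarr s ''Z'' a b = ?g a b"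
          with s2 show "spans_solutions p (insert e M) (rarr s ''Z'')"
            by (intro spans_solutions_cut[OF Z, of "ivar s2 ''q''"]) auto
        qed (use s3 in \<open>auto\<close>)
      qed
    qed
  qed
  from runs_frame[OF this] show ?thesis
  proof (rule runs_mono)
    \<comment> \<open>Estimating 1 and \<open>p\<close> by \<open>p * p\<close> bounds the time by
      \<open>182 * (p * p)\<close>.\<close>
    have "p \<le> p * p" "1 \<le> p * p" using p by auto
    then show "1 + p * p * 60 + (1 + p * 30 + (1 + p * p * 51 + p * p * 38)) \<le> T" using time by linarith
  qed (use post in blast)
qed

section \<open>Setting up the two linear systems\<close>

definition ident :: com where
  "ident = Seq (fill ''Z'' (RConst 0)) (For ''i'' ''p'' (RArrAssign ''Z'' Ii Ii (RConst 1)))"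

lemma writes_ident [simp]: "writes ident = {''i'', ''j'', ''Z''}"
  by (auto simp: ident_def)

text \<open>With the unit vectors as rows, each vector is its own coefficient family.\<close>

lemma spans_solutions_ident:
  assumes "\<And>i j. i < p \<Longrightarrow> j < p \<Longrightarrow> Z i j = (if j = i then 1 else 0)"
  shows "spans_solutions p {} Z"
proof -
  have "x j = (\<Sum>i<p. x i * Z i j)" if j: "j < p" for x :: "nat \<Rightarrow> real" and j
  proof -
    have "(\<Sum>i<p. x i * Z i j) = (\<Sum>i<p. if i = j then x i else 0)"
      by (rule sum.cong) (use assms j in auto)
    then show ?thesis using j by simp
  qed
  then show ?thesis unfolding spans_solutions_def by blast
qed

lemma runs_ident:
  assumes p: "ivar s0 ''p'' = p" "p \<ge> 1"
    and post: "\<And>s. spans_solutions p {} (rarr s ''Z'') \<Longrightarrow> same_outside (writes ident) s0 s \<Longrightarrow> Q s"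
    and time: "p * p * 60 \<le> T"
  shows "runs ident s0 T Q"
proof -
  have "runs ident s0 (1 + p * p * 36 + p * 20) (\<lambda>s. spans_solutions p {} (rarr s ''Z''))"
    unfolding ident_def
  proof (rule runs_Seq)
    show "runs (fill ''Z'' (RConst 0)) s0 (p * p * 36)
      (\<lambda>s. (\<forall>a<p. \<forall>b<p. rarr s ''Z'' a b = 0) \<and> ivar s ''p'' = p)"
      by (rule runs_fill[where g = "\<lambda>_ _. 0", OF _ p]) (use p in \<open>auto simp: same_outside_def\<close>)
    fix s1 :: state assume s1: "(\<forall>a<p. \<forall>b<p. rarr s1 ''Z'' a b = 0) \<and> ivar s1 ''p'' = p"
    let ?P = "\<lambda>k s. \<forall>a<p. \<forall>b<p. rarr s ''Z'' a b = (if b = a \<and> a < k then 1 else 0)"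
    show "runs (For ''i'' ''p'' (RArrAssign ''Z'' Ii Ii (RConst 1))) s1 (p * 20)
      (\<lambda>s. spans_solutions p {} (rarr s ''Z''))"
    proof (rule runs_For[where P = ?P and T = 4, OF _ _ _ _ p(2)])
      fix k and s :: state assume "k < p" and P: "?P k s" and i: "ivar s ''i'' = k"
      have "runs (RArrAssign ''Z'' Ii Ii (RConst 1)) s (1 + icost Ii + icost Ii + rcost (RConst 1))
        (?P (Suc k))"
        by (rule runs_RArrAssign) (use P i in auto)
      then show "runs (RArrAssign ''Z'' Ii Ii (RConst 1)) s 4 (?P (Suc k))"
        by (rule runs_mono) auto
    qed (use s1 in \<open>auto intro!: spans_solutions_ident\<close>)
  qed
  from runs_frame[OF this] show ?thesis
  proof (rule runs_mono)
    have "p \<le> p * p" "1 \<le> p * p" using p by auto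
    then show "1 + p * p * 36 + p * 20 \<le> T" using time by linarith
  qed (use post in blast)
qed

definition equation :: "rexp \<Rightarrow> com" where
  "equation r = Seq (fill ''E'' r) cut_solutions"

lemma writes_equation [simp]:
  "writes (equation r) = {''i'', ''j'', ''E'', ''d'', ''q'', ''W'', ''Z''}"
  by (auto simp: equation_def)

text \<open>The 236 beyond \<open>rcost r\<close> consists of 35 for filling \<open>E\<close>, 200
  for the cut and 1 for sequencing.\<close>

lemma runs_equation:
  assumes p: "ivar s0 ''p'' = p" "p \<ge> 1"
    and Z: "spans_solutions p M (rarr s0 ''Z'')"
    and val: "\<And>s b. b < p \<Longrightarrow> same_outside {''i'', ''j'', ''E''} s0 s \<Longrightarrow> ivar s ''j'' = b \<Longrightarrow>
      rval r s = e b"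
    and post: "\<And>s. spans_solutions p (insert e M) (rarr s ''Z'') \<Longrightarrow> Q s"
    and time: "p * p * (rcost r + 236) \<le> T"
  shows "runs (equation r) s0 T Q"
proof -
  have "runs (equation r) s0 (1 + p * p * (rcost r + 35) + p * p * 200) Q"
    unfolding equation_def
  proof (rule runs_Seq)
    show "runs (fill ''E'' r) s0 (p * p * (rcost r + 35)) (\<lambda>s. (\<forall>a<p. \<forall>b<p. rarr s ''E'' a b = e b) \<and>
      ivar s ''p'' = p \<and> rarr s ''Z'' = rarr s0 ''Z'')"
      by (rule runs_fill[where g = "\<lambda>_. e", OF _ p])
        (use p val in \<open>auto simp: same_outsideD(1,3)\<close>)
    fix s1 :: state assume "(\<forall>a<p. \<forall>b<p. rarr s1 ''E'' a b = e b) \<and>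
      ivar s1 ''p'' = p \<and> rarr s1 ''Z'' = rarr s0 ''Z''"
    then show "runs cut_solutions s1 (p * p * 200) Q"
      by (intro runs_cut[where M = M and e = e]) (use p Z post in auto)
  qed
  then show ?thesis
  proof (rule runs_mono)
    have "1 \<le> p * p" using p by auto
    moreover have "p * p * (rcost r + 236) = p * p * (rcost r + 35) + p * p * 201"
      by (simp add: algebra_simps)
    ultimately show "1 + p * p * (rcost r + 35) + p * p * 200 \<le> T" using time by linarith
  qed
qed

text \<open>The unknowns are the coefficients of a combination of the generators; round
  \<open>l\<close> demands that its coordinate \<open>l\<close> vanish.\<close>

definition relations :: com where
  "relations = For ''l'' ''n'' (equation (RArr ''v'' Ij (IVar ''l'')))"

lemma writes_relations [simp]:
  "writes relations = {''l'', ''i'', ''j'', ''E'', ''d'', ''q'', ''W'', ''Z''}"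
  by (simp add: relations_def)

lemma runs_relations:
  assumes p: "ivar s0 ''p'' = p" "p \<ge> 1" and n: "ivar s0 ''n'' = n" "n \<ge> 1"
    and Z: "spans_solutions p {} (rarr s0 ''Z'')"
    and post: "\<And>s. spans_solutions p ((\<lambda>l j. rarr s0 ''v'' j l) ` {..<n}) (rarr s ''Z'') \<Longrightarrow>
      same_outside (writes relations) s0 s \<Longrightarrow> Q s"
  shows "runs relations s0 (n * (p * p * 239 + 16)) Q"
proof -
  let ?e = "\<lambda>l j. rarr s0 ''v'' j l"
  let ?r = "RArr ''v'' Ij (IVar ''l'')"
  show ?thesis
    unfolding relations_def
  proof (rule runs_For[where P = "\<lambda>k s. spans_solutions p (?e ` {..<k}) (rarr s ''Z'')", OF _ _ _ n])
    fix k s assume k: "k < n" and P: "spans_solutions p (?e ` {..<k}) (rarr s ''Z'')"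
      and l: "ivar s ''l'' = k"
      and S: "same_outside (insert ''l'' (writes (equation ?r))) s0 s"
    show "runs (equation ?r) s (p * p * 239) (\<lambda>s. spans_solutions p (?e ` {..<Suc k}) (rarr s ''Z''))"
    proof (rule runs_equation[OF _ p(2) P, where e = "?e k"])
      show "ivar s ''p'' = p" using S p by (auto simp: same_outside_def)
      fix s' b assume "same_outside {''i'', ''j'', ''E''} s s'" "ivar s' ''j'' = b"
      then show "rval ?r s' = ?e k b" using S l by (auto simp: same_outside_def)
    qed (simp_all add: lessThan_Suc)
  qed (use Z post in \<open>auto simp: relations_def\<close>)
qed

text \<open>The unknowns are the weights; round \<open>(r, l)\<close> demands that coordinate
  \<open>l\<close> of relation \<open>r\<close>, carried over to the weighted
  \<open>v (\<sigma> j)\<close>, vanish. These \<open>p * n\<close> equations at cost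
  \<open>O(p\<^sup>2)\<close> dominate the running time.\<close>

definition scalings :: com where
  "scalings = For ''r'' ''p'' (For ''l'' ''n'' (equation
     (RMul (RArr ''Rel'' (IVar ''r'') Ij) (RArr ''v'' (IArr ''sigma'' Ij) (IVar ''l'')))))"

lemma writes_scalings [simp]:
  "writes scalings = {''r'', ''l'', ''i'', ''j'', ''E'', ''d'', ''q'', ''W'', ''Z''}"
  by (simp add: scalings_def)

lemma runs_scalings:
  assumes p: "ivar s0 ''p'' = p" "p \<ge> 1" and n: "ivar s0 ''n'' = n" "n \<ge> 1"
    and Z: "spans_solutions p {} (rarr s0 ''Z'')"
    and post: "\<And>s. spans_solutions p ((\<lambda>(r, l) j. rarr s0 ''Rel'' r j * rarr s0 ''v'' (iarr s0 ''sigma'' j) l) `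
        ({..<p} \<times> {..<n})) (rarr s ''Z'') \<Longrightarrow> same_outside (writes scalings) s0 s \<Longrightarrow> Q s"
  shows "runs scalings s0 (p * (n * (p * p * 244 + 16) + 16)) Q"
proof -
  let ?e = "\<lambda>(r, l) j. rarr s0 ''Rel'' r j * rarr s0 ''v'' (iarr s0 ''sigma'' j) l"
  let ?r = "RMul (RArr ''Rel'' (IVar ''r'') Ij) (RArr ''v'' (IArr ''sigma'' Ij) (IVar ''l''))"
  \<comment> \<open>The equations imposed by \<open>k\<close> complete relations and the first
    \<open>m\<close> coordinates of relation \<open>k\<close>; \<open>Mn\<close> leads from the end
    of the inner loop to the next outer round.\<close>
  let ?M = "\<lambda>k m. ?e ` ({..<k} \<times> {..<n}) \<union> (\<lambda>l. ?e (k, l)) ` {..<m}"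
  have M0: "?M k 0 = ?e ` ({..<k} \<times> {..<n})" for k by simp
  have Mn: "?M k n = ?e ` ({..<Suc k} \<times> {..<n})" for k
    by (auto simp: lessThan_Suc image_iff)
  have MS: "?M k (Suc m) = insert (?e (k, m)) (?M k m)" for k m
    by (auto simp: lessThan_Suc)
  show ?thesis
    unfolding scalings_def
  proof (rule runs_For[where P = "\<lambda>k s. spans_solutions p (?M k 0) (rarr s ''Z'')", OF _ _ _ p])
    fix k s assume k: "k < p" and P: "spans_solutions p (?M k 0) (rarr s ''Z'')"
      and r: "ivar s ''r'' = k"
      and S: "same_outside (insert ''r'' (writes (For ''l'' ''n'' (equation ?r)))) s0 s"
    have n': "ivar s ''n'' = n" using S n by (auto simp: same_outside_def)
    show "runs (For ''l'' ''n'' (equation ?r)) s (n * (p * p * 244 + 16))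
      (\<lambda>s. spans_solutions p (?M (Suc k) 0) (rarr s ''Z''))"
    proof (rule runs_For[where P = "\<lambda>m s. spans_solutions p (?M k m) (rarr s ''Z'')", OF _ _ _ n' n(2)])
      fix m s1 assume m: "m < n" and P: "spans_solutions p (?M k m) (rarr s1 ''Z'')"
        and l: "ivar s1 ''l'' = m"
        and S1: "same_outside (insert ''l'' (writes (equation ?r))) s s1"
      show "runs (equation ?r) s1 (p * p * 244) (\<lambda>s. spans_solutions p (?M k (Suc m)) (rarr s ''Z''))"
      proof (rule runs_equation[OF _ p(2) P, where e = "?e (k, m)"])
        show "ivar s1 ''p'' = p" using S S1 p by (auto simp: same_outside_def)
        fix s' b assume "same_outside {''i'', ''j'', ''E''} s1 s'" "ivar s' ''j'' = b"
        then show "rval ?r s' = ?e (k, m) b" using S S1 l r by (auto simp: same_outside_def)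
      next
        fix s' assume "spans_solutions p (insert (?e (k, m)) (?M k m)) (rarr s' ''Z'')"
        then show "spans_solutions p (?M k (Suc m)) (rarr s' ''Z'')" unfolding MS .
      qed simp
    next
      fix s1 :: state assume "spans_solutions p (?M k n) (rarr s1 ''Z'')"
      then show "spans_solutions p (?M (Suc k) 0) (rarr s1 ''Z'')" unfolding Mn M0 .
    qed (use P in \<open>auto\<close>)
  qed (use Z post in \<open>auto simp: scalings_def\<close>)
qed

text \<open>Multiplying by the first entry treats positive and negative rows alike, and the case
  \<open>j = 0\<close> excludes a vanishing first entry. Once set, \<open>result\<close> is never
  reset.\<close>

definition check :: com where
  "check = For ''i'' ''p'' (Seq (IVarAssign ''f'' (IConst 1)) (Seq
     (For ''j'' ''p'' (If (RLess (RConst 0) (RMul (RArr ''Z'' Ii (IConst 0)) (RArr ''Z'' Ii Ij)))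
        Skip (IVarAssign ''f'' (IConst 0))))
     (If (IEq (IVar ''f'') (IConst 1)) (IVarAssign ''result'' (IConst 1)) Skip)))"

lemma runs_check:
  assumes p: "ivar s0 ''p'' = p" "p \<ge> 1" and res: "ivar s0 ''result'' = 0"
    and Z: "rarr s0 ''Z'' = Z"
  shows "runs check s0 (p * (p * 28 + 26))
    (\<lambda>s. ivar s ''result'' = (if \<exists>i<p. \<forall>j<p. 0 < Z i 0 * Z i j then 1 else 0))"
proof -
  let ?b = "RLess (RConst 0) (RMul (RArr ''Z'' Ii (IConst 0)) (RArr ''Z'' Ii Ij))"
  let ?I = "If ?b Skip (IVarAssign ''f'' (IConst 0))"
  let ?J = "If (IEq (IVar ''f'') (IConst 1)) (IVarAssign ''result'' (IConst 1)) Skip"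
  let ?c = "Seq (IVarAssign ''f'' (IConst 1)) (Seq (For ''j'' ''p'' ?I) ?J)"
  define ok where "ok i \<longleftrightarrow> (\<forall>j<p. 0 < Z i 0 * Z i j)" for i
  let ?P = "\<lambda>k s. ivar s ''result'' = (if \<exists>i<k. ok i then 1 else 0)"
  have w: "writes ?c = {''f'', ''j'', ''result''}" by auto
  show ?thesis
    unfolding check_def ok_def[symmetric]
  proof (rule runs_For[where P = ?P and T = "1 + 2 + (1 + p * 28 + 6)", OF _ _ _ p])
    fix k s assume k: "k < p" and P: "?P k s" and i: "ivar s ''i'' = k"
      and S: "same_outside (insert ''i'' (writes ?c)) s0 s"
    let ?F = "\<lambda>m s'. ivar s' ''f'' = (if \<forall>j<m. 0 < Z k 0 * Z k j then 1 else 0) \<and>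
      same_outside {''f'', ''j''} s s'"
    show "runs ?c s (1 + 2 + (1 + p * 28 + 6)) (?P (Suc k))"
    proof (rule runs_Seq[where P = "?F 0"])
      have "runs (IVarAssign ''f'' (IConst 1)) s (1 + icost (IConst 1)) (?F 0)"
        by (rule runs_IVarAssign) (auto simp: same_outside_def)
      then show "runs (IVarAssign ''f'' (IConst 1)) s 2 (?F 0)" by (rule runs_mono) auto
      fix s1 :: state assume s1: "?F 0 s1"
      have p1: "ivar s1 ''p'' = p" using S s1 p unfolding w by (auto simp: same_outside_def)
      show "runs (Seq (For ''j'' ''p'' ?I) ?J) s1 (1 + p * 28 + 6) (?P (Suc k))"
      proof (rule runs_Seq[where P = "?F p"])
        show "runs (For ''j'' ''p'' ?I) s1 (p * 28) (?F p)"
        proof (rule runs_For[where P = ?F and T = 12, OF _ _ _ p1 p(2)])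
          fix m s2 assume m: "m < p" and F: "?F m s2" and j: "ivar s2 ''j'' = m"
          have e: "ivar s2 ''i'' = k" "rarr s2 ''Z'' = Z"
            using F S i Z unfolding w by (auto simp: same_outside_def)
          have "runs ?I s2 (1 + bcost ?b + 2) (?F (Suc m))"
          proof (rule runs_If)
            assume "bval ?b s2"
            then have "?F (Suc m) s2" using F e j by (auto simp: less_Suc_eq)
            from runs_Skip[of "?F (Suc m)", OF this] show "runs Skip s2 2 (?F (Suc m))"
              by (rule runs_mono) auto
          next
            assume b: "\<not> bval ?b s2"
            have "runs (IVarAssign ''f'' (IConst 0)) s2 (1 + icost (IConst 0)) (?F (Suc m))"
              by (rule runs_IVarAssign) (use b e j F in \<open>auto simp: same_outside_def\<close>)
            then show "runs (IVarAssign ''f'' (IConst 0)) s2 2 (?F (Suc m))"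
              by (rule runs_mono) auto
          qed
          then show "runs ?I s2 12 (?F (Suc m))" by (rule runs_mono) auto
        qed (use s1 in \<open>auto simp: same_outside_def\<close>)
        fix s3 :: state assume F: "?F p s3"
        have f: "ivar s3 ''f'' = (if ok k then 1 else 0)" using F unfolding ok_def by (rule conjunct1)
        have res: "ivar s3 ''result'' = ivar s ''result''" using F by (auto simp: same_outside_def)
        have "runs ?J s3 (1 + bcost (IEq (IVar ''f'') (IConst 1)) + 2) (?P (Suc k))"
        proof (rule runs_If)
          assume "bval (IEq (IVar ''f'') (IConst 1)) s3"
          then have *: "ok k" using f by (cases "ok k") simp_all
          have "runs (IVarAssign ''result'' (IConst 1)) s3 (1 + icost (IConst 1)) (?P (Suc k))"
            by (rule runs_IVarAssign) (use * lessI[of k] in \<open>auto simp del: lessI\<close>)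
          then show "runs (IVarAssign ''result'' (IConst 1)) s3 2 (?P (Suc k))"
            by (rule runs_mono) auto
        next
          assume "\<not> bval (IEq (IVar ''f'') (IConst 1)) s3"
          then have "\<not> ok k" using f by (cases "ok k") simp_all
          then have "(\<exists>i<Suc k. ok i) = (\<exists>i<k. ok i)"
            unfolding less_Suc_eq by blast
          then have "?P (Suc k) s3" using P res by simp
          from runs_Skip[of "?P (Suc k)", OF this] show "runs Skip s3 2 (?P (Suc k))"
            by (rule runs_mono) auto
        qed
        then show "runs ?J s3 6 (?P (Suc k))" by (rule runs_mono) auto
      qed
    qed
  qed (use res in auto)
qed

text \<open>The relations are saved in \<open>Rel\<close> because the second system reuses
  \<open>Z\<close> as its working array.\<close>

definition decide :: com where
  "decide = Seq ident (Seq relations (Seq (fill ''Rel'' (RArr ''Z'' Ii Ij))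
     (Seq ident (Seq scalings check))))"

text \<open>Correctness depends only on what \<open>Rel\<close> and \<open>Z\<close> span, hence the
  existential quantifiers. The conditionals reproduce the zero padding of
  \<open>input_state\<close>.\<close>

lemma runs_decide:
  assumes p: "p \<ge> 1" and n: "n \<ge> 1"
  shows "runs decide (input_state n p v \<sigma>) (2000 * (p ^ 3 * n))
    (\<lambda>s. \<exists>Rel Z.
       spans_solutions p ((\<lambda>l j. if j < p \<and> l < n then v j $ l else 0) ` {..<n}) Rel \<and>
       spans_solutions p ((\<lambda>(r, l) j. Rel r j *
         (let k = if j < p then \<sigma> j else 0 in if k < p \<and> l < n then v k $ l else 0)) ` ({..<p} \<times> {..<n})) Z \<and>
       ivar s ''result'' = (if \<exists>i<p. \<forall>j<p. 0 < Z i 0 * Z i j then 1 else 0))"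
proof -
  let ?s = "input_state n p v \<sigma>"
  let ?V = "\<lambda>j l. if j < p \<and> l < n then v j $ l else 0"
  let ?g = "\<lambda>j. if j < p then \<sigma> j else 0"
  let ?M1 = "(\<lambda>l j. ?V j l) ` {..<n}"
  let ?M2 = "\<lambda>Rel. (\<lambda>(r, l) j. Rel r j * ?V (?g j) l) ` ({..<p} \<times> {..<n})"
  let ?In = "\<lambda>s. ivar s ''p'' = p \<and> ivar s ''n'' = n \<and> ivar s ''result'' = 0 \<and>
    rarr s ''v'' = ?V \<and> iarr s ''sigma'' = ?g"
  let ?Q = "\<lambda>s. \<exists>Rel Z. spans_solutions p ?M1 Rel \<and> spans_solutions p (?M2 Rel) Z \<and>
    ivar s ''result'' = (if \<exists>i<p. \<forall>j<p. 0 < Z i 0 * Z i j then 1 else 0)"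
  let ?T = "1 + p * p * 60 + (1 + n * (p * p * 239 + 16) + (1 + p * p * 38 + (1 + p * p * 60 +
    (1 + p * (n * (p * p * 244 + 16) + 16) + p * (p * 28 + 26)))))"
  have In: "?In ?s" by (simp add: input_state_def)
  have "runs decide ?s ?T ?Q"
    unfolding decide_def
  proof (rule runs_Seq, rule runs_ident[OF _ p _ order_refl])
    show "ivar ?s ''p'' = p" using In by simp
    fix s :: state assume "spans_solutions p {} (rarr s ''Z'')" "same_outside (writes ident) ?s s"
    then show "?In s \<and> spans_solutions p {} (rarr s ''Z'')" using In by (auto simp: same_outsideD)
  next
    fix s :: state assume s: "?In s \<and> spans_solutions p {} (rarr s ''Z'')"
    show "runs (Seq relations (Seq (fill ''Rel'' (RArr ''Z'' Ii Ij)) (Seq ident (Seq scalings check)))) s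
      (1 + n * (p * p * 239 + 16) + (1 + p * p * 38 + (1 + p * p * 60 +
       (1 + p * (n * (p * p * 244 + 16) + 16) + p * (p * 28 + 26))))) ?Q"
    proof (rule runs_Seq[where P = "\<lambda>s. ?In s \<and> spans_solutions p ?M1 (rarr s ''Z'')"],
        rule runs_relations[OF _ p _ n])
      fix s1 :: state assume "spans_solutions p ((\<lambda>l j. rarr s ''v'' j l) ` {..<n}) (rarr s1 ''Z'')"
        "same_outside (writes relations) s s1"
      then show "?In s1 \<and> spans_solutions p ?M1 (rarr s1 ''Z'')" using s by (auto simp: same_outsideD)
    next
      fix s1 :: state assume s1: "?In s1 \<and> spans_solutions p ?M1 (rarr s1 ''Z'')"
      let ?Z1 = "rarr s1 ''Z''"
      show "runs (Seq (fill ''Rel'' (RArr ''Z'' Ii Ij)) (Seq ident (Seq scalings check))) s1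
        (1 + p * p * 38 + (1 + p * p * 60 +
         (1 + p * (n * (p * p * 244 + 16) + 16) + p * (p * 28 + 26)))) ?Q"
      proof (rule runs_Seq[where P = "\<lambda>s. ?In s \<and> spans_solutions p ?M1 (rarr s ''Rel'')"],
          rule runs_fill[where g = ?Z1, OF _ _ p])
        fix s' a b assume "same_outside {''i'', ''j'', ''Rel''} s1 s'" "ivar s' ''i'' = a" "ivar s' ''j'' = b"
        then show "rval (RArr ''Z'' Ii Ij) s' = ?Z1 a b" by (auto simp: same_outsideD)
      next
        fix s2 :: state assume R: "\<And>a b. a < p \<Longrightarrow> b < p \<Longrightarrow> rarr s2 ''Rel'' a b = ?Z1 a b"
          and S: "same_outside {''i'', ''j'', ''Rel''} s1 s2"
        have "spans_solutions p ?M1 (rarr s2 ''Rel'')"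
          using s1 spans_solutions_cong[of p "rarr s2 ''Rel''" ?Z1 ?M1] R by blast
        then show "?In s2 \<and> spans_solutions p ?M1 (rarr s2 ''Rel'')"
          using S s1 by (auto simp: same_outsideD)
      next
        fix s2 :: state assume s2: "?In s2 \<and> spans_solutions p ?M1 (rarr s2 ''Rel'')"
        let ?R = "rarr s2 ''Rel''"
        show "runs (Seq ident (Seq scalings check)) s2 (1 + p * p * 60 +
         (1 + p * (n * (p * p * 244 + 16) + 16) + p * (p * 28 + 26))) ?Q"
        proof (rule runs_Seq[where P = "\<lambda>s. ?In s \<and> rarr s ''Rel'' = ?R \<and> spans_solutions p {} (rarr s ''Z'')"],
            rule runs_ident[OF _ p _ order_refl])
          fix s3 :: state assume "spans_solutions p {} (rarr s3 ''Z'')" "same_outside (writes ident) s2 s3"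
          then show "?In s3 \<and> rarr s3 ''Rel'' = ?R \<and> spans_solutions p {} (rarr s3 ''Z'')"
            using s2 by (auto simp: same_outsideD)
        next
          fix s3 :: state assume s3: "?In s3 \<and> rarr s3 ''Rel'' = ?R \<and> spans_solutions p {} (rarr s3 ''Z'')"
          show "runs (Seq scalings check) s3
            (1 + p * (n * (p * p * 244 + 16) + 16) + p * (p * 28 + 26)) ?Q"
          proof (rule runs_Seq[where P = "\<lambda>s. ?In s \<and> spans_solutions p (?M2 ?R) (rarr s ''Z'')"],
              rule runs_scalings[OF _ p _ n])
            fix s4 :: state assume "spans_solutions p ((\<lambda>(r, l) j. rarr s3 ''Rel'' r j *
                rarr s3 ''v'' (iarr s3 ''sigma'' j) l) ` ({..<p} \<times> {..<n})) (rarr s4 ''Z'')"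
              "same_outside (writes scalings) s3 s4"
            then show "?In s4 \<and> spans_solutions p (?M2 ?R) (rarr s4 ''Z'')"
              using s3 by (simp add: same_outsideD)
          next
            fix s4 :: state assume s4: "?In s4 \<and> spans_solutions p (?M2 ?R) (rarr s4 ''Z'')"
            then have "runs check s4 (p * (p * 28 + 26)) (\<lambda>s. ivar s ''result'' =
              (if \<exists>i<p. \<forall>j<p. 0 < rarr s4 ''Z'' i 0 * rarr s4 ''Z'' i j then 1 else 0))"
              by (intro runs_check[OF _ p]) auto
            then show "runs check s4 (p * (p * 28 + 26)) ?Q"
              by (rule runs_mono[OF _ order_refl]) (use s2 s4 in blast)
          qed (use s3 in auto)
        qed (use s2 in auto)
      qed (use s1 in auto)
    qed (use s in auto)
  qed
  then show ?thesis
    unfolding Let_def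
  proof (rule runs_mono)
    \<comment> \<open>Since \<open>p\<close> and \<open>n\<close> are positive, every monomial of
      the bound is at most \<open>p ^ 3 * n\<close>; the coefficients add up to 748.\<close>
    define N where "N = p ^ 3 * n"
    have "1 \<le> N" using p n by (simp add: N_def)
    moreover have "p * p * n \<le> N" unfolding N_def power3_eq_cube using p by simp
    moreover have "p * p \<le> p * p * n" "p \<le> p * p" "n \<le> p * p * n" "p * n \<le> p * p * n"
      using p n by simp_all
    moreover have "?T = 5 + 158 * (p * p) + 239 * (p * p * n) + 16 * n + 244 * N + 16 * (p * n)
       + 16 * p + 28 * (p * p) + 26 * p"
      by (simp add: N_def algebra_simps power3_eq_cube)
    ultimately show "?T \<le> 2000 * (p ^ 3 * n)" unfolding N_def[symmetric] by linarith
  qed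
qed

section \<open>Correctness of the procedure\<close>

context nondecomposable_cone
begin

lemma relations_iff:
  "(\<forall>e\<in>(\<lambda>l j. if j < p \<and> l < n then v j $ l else 0) ` {..<n}. dotp p e c = 0) \<longleftrightarrow>
     lcomb n {..<p} c v = 0\<^sub>v n"
proof -
  have "dotp p (\<lambda>j. if j < p \<and> l < n then v j $ l else 0) c = (\<Sum>j<p. c j * v j $ l)" if "l < n" for l
    unfolding dotp_def by (rule sum.cong) (use that in auto)
  then show ?thesis by (auto simp: lcomb_eq_0_iff)
qed

text \<open>The condition on \<open>\<mu>\<close> is linear in the relation, so imposing it on a
  spanning set of relations suffices. This replaces the quantification over all relations by
  finitely many equations.\<close>

lemma scaling_iff:
  assumes Rel: "spans_solutions p ((\<lambda>l j. if j < p \<and> l < n then v j $ l else 0) ` {..<n}) Rel"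
  shows "(\<forall>e\<in>(\<lambda>(r, l) j. Rel r j *
      (let k = if j < p then \<sigma> j else 0 in if k < p \<and> l < n then v k $ l else 0)) ` ({..<p} \<times> {..<n}).
      dotp p e \<mu> = 0) \<longleftrightarrow> scaling \<mu>" (is "?L \<longleftrightarrow> _")
proof -
  have "dotp p (\<lambda>j. Rel r j *
      (let k = if j < p then \<sigma> j else 0 in if k < p \<and> l < n then v k $ l else 0)) \<mu>
      = (\<Sum>j<p. Rel r j * \<mu> j * v (\<sigma> j) $ l)" if "l < n" for r l
    unfolding dotp_def by (rule sum.cong) (use that \<sigma>_less in auto)
  then have L: "?L \<longleftrightarrow> (\<forall>r<p. \<forall>l<n. (\<Sum>j<p. Rel r j * \<mu> j * v (\<sigma> j) $ l) = 0)"
    by fastforce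
  show ?thesis
  proof
    assume "scaling \<mu>"
    moreover have "lcomb n {..<p} (Rel r) v = 0\<^sub>v n" if "r < p" for r
      using Rel that relations_iff unfolding spans_solutions_def by blast
    ultimately show ?L unfolding L by (simp add: scaling_def lcomb_eq_0_iff)
  next
    assume ?L
    then have R: "\<And>r l. r < p \<Longrightarrow> l < n \<Longrightarrow> (\<Sum>j<p. Rel r j * \<mu> j * v (\<sigma> j) $ l) = 0"
      unfolding L by blast
    show "scaling \<mu>" unfolding scaling_def
    proof (intro allI impI)
      fix c assume "lcomb n {..<p} c v = 0\<^sub>v n"
      then obtain b where b: "\<And>j. j < p \<Longrightarrow> c j = (\<Sum>r<p. b r * Rel r j)"
        using Rel relations_iff unfolding spans_solutions_def by meson
      have "(\<Sum>j<p. c j * \<mu> j * v (\<sigma> j) $ l) = 0" if l: "l < n" for l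
      proof -
        have "(\<Sum>j<p. c j * \<mu> j * v (\<sigma> j) $ l)
            = (\<Sum>j<p. \<Sum>r<p. b r * (Rel r j * \<mu> j * v (\<sigma> j) $ l))"
          by (rule sum.cong) (simp_all add: b sum_distrib_right mult.assoc)
        also have "\<dots> = (\<Sum>r<p. b r * (\<Sum>j<p. Rel r j * \<mu> j * v (\<sigma> j) $ l))"
          unfolding sum_distrib_left by (rule sum.swap)
        also have "\<dots> = 0" using R[OF _ l] by simp
        finally show ?thesis .
      qed
      then show "lcomb n {..<p} (\<lambda>i. c i * \<mu> i) (\<lambda>i. v (\<sigma> i)) = 0\<^sub>v n"
        by (simp add: lcomb_eq_0_iff)
    qed
  qed
qed

text \<open>If a positive scaling \<open>\<mu>\<close> exists, all rows are multiples of it by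
  \<open>scaling_unique\<close>, and a nonzero multiple has constant sign. Conversely, a row of
  constant strict sign becomes positive after multiplication by its first entry.\<close>

lemma Proj_iff_row:
  assumes Z: "\<And>i. i < p \<Longrightarrow> scaling (Z i)"
    and span: "\<And>\<mu>. scaling \<mu> \<Longrightarrow> \<exists>c. \<forall>j<p. \<mu> j = (\<Sum>i<p. c i * Z i j)"
  shows "\<sigma> \<in> Proj n C p R \<longleftrightarrow> (\<exists>i<p. \<forall>j<p. 0 < Z i 0 * Z i j)"
proof
  assume "\<sigma> \<in> Proj n C p R"
  then obtain \<mu> where pos: "\<And>i. i < p \<Longrightarrow> 0 < \<mu> i" and \<mu>: "scaling \<mu>"
    unfolding Proj_iff_scaling by blast
  obtain c where c: "\<And>j. j < p \<Longrightarrow> \<mu> j = (\<Sum>i<p. c i * Z i j)" using span[OF \<mu>] by blast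
  \<comment> \<open>The rows span \<open>\<mu>\<close>, whose entry at 0 is positive, so they cannot
    all vanish there.\<close>
  have "\<exists>i<p. Z i 0 \<noteq> 0"
  proof (rule ccontr)
    assume "\<not> ?thesis"
    then have "\<mu> 0 = 0" using c[of 0] p_pos by simp
    then show False using pos[of 0] p_pos by simp
  qed
  then obtain i where i: "i < p" "Z i 0 \<noteq> 0" by blast
  obtain a where a: "\<And>j. j < p \<Longrightarrow> Z i j = a * \<mu> j" using scaling_unique[OF \<mu> pos Z[OF i(1)]] by blast
  have "0 < Z i 0 * Z i j" if j: "j < p" for j
  proof -
    have "Z i 0 * Z i j = (a * a) * (\<mu> 0 * \<mu> j)" using a[of 0] a[OF j] p_pos by simp
    moreover have "a \<noteq> 0" using i(2) a[of 0] p_pos by auto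
    moreover have "0 < \<mu> 0 * \<mu> j" using pos[of 0] pos[OF j] p_pos by simp
    ultimately show ?thesis by (metis mult_pos_pos not_real_square_gt_zero)
  qed
  then show "\<exists>i<p. \<forall>j<p. 0 < Z i 0 * Z i j" using i by blast
next
  assume "\<exists>i<p. \<forall>j<p. 0 < Z i 0 * Z i j"
  then obtain i where i: "i < p" "\<And>j. j < p \<Longrightarrow> 0 < Z i 0 * Z i j" by blast
  \<comment> \<open>The constant \<open>Z i 0\<close> can be moved into the relation, where it
    yields another relation.\<close>
  have "scaling (\<lambda>j. Z i 0 * Z i j)"
    unfolding scaling_def
  proof (intro allI impI)
    fix c assume "lcomb n {..<p} c v = 0\<^sub>v n"
    then have "lcomb n {..<p} (\<lambda>j. Z i 0 * c j) v = 0\<^sub>v n"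
      unfolding lcomb_scale by (auto simp: vec_eq_iff)
    then have "lcomb n {..<p} (\<lambda>j. Z i 0 * c j * Z i j) (\<lambda>j. v (\<sigma> j)) = 0\<^sub>v n"
      using Z[OF i(1)] unfolding scaling_def by blast
    then show "lcomb n {..<p} (\<lambda>j. c j * (Z i 0 * Z i j)) (\<lambda>j. v (\<sigma> j)) = 0\<^sub>v n"
      by (simp only: mult.assoc mult.left_commute[of "Z i 0"])
  qed
  with i(2) show "\<sigma> \<in> Proj n C p R"
    unfolding Proj_iff_scaling by (intro exI[of _ "\<lambda>j. Z i 0 * Z i j"]) simp
qed

lemma decide_correct:
  "answers_within decide (input_state n p v \<sigma>) (2000 * (p ^ 3 * n)) (\<sigma> \<in> Proj n C p R)"
proof -
  obtain t s Rel Z where t: "exec decide (input_state n p v \<sigma>) t s" "t \<le> 2000 * (p ^ 3 * n)"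
    and Rel: "spans_solutions p ((\<lambda>l j. if j < p \<and> l < n then v j $ l else 0) ` {..<n}) Rel"
    and Z: "spans_solutions p ((\<lambda>(r, l) j. Rel r j *
         (let k = if j < p then \<sigma> j else 0 in if k < p \<and> l < n then v k $ l else 0)) ` ({..<p} \<times> {..<n})) Z"
    and res: "ivar s ''result'' = (if \<exists>i<p. \<forall>j<p. 0 < Z i 0 * Z i j then 1 else 0)"
    using runs_decide[OF p_pos n_pos, of v \<sigma>] unfolding runs_def by blast
  have "\<sigma> \<in> Proj n C p R \<longleftrightarrow> (\<exists>i<p. \<forall>j<p. 0 < Z i 0 * Z i j)"
  proof (rule Proj_iff_row)
    show "scaling (Z i)" if "i < p" for i
      using Z that unfolding spans_solutions_def scaling_iff[OF Rel, symmetric] by blast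
    show "\<exists>c. \<forall>j<p. \<mu> j = (\<Sum>i<p. c i * Z i j)" if "scaling \<mu>" for \<mu>
      using Z that unfolding spans_solutions_def scaling_iff[OF Rel, symmetric] by blast
  qed
  then show ?thesis
    unfolding answers_within_def by (intro exI[of _ t] exI[of _ s]) (simp add: t res)
qed

end

theorem theorem9:
  shows "\<exists>(prog :: com) (K :: nat).
    \<forall>(n :: nat) (p :: nat) (C :: real vec set) (R :: nat \<Rightarrow> real vec set)
      (v :: nat \<Rightarrow> real vec) (\<sigma> :: nat \<Rightarrow> nat).
      n \<ge> 1 \<and>
      polyhedral_cone n C \<and> full_dimensional n C \<and> pointed n C \<and> \<not> decomposable n C \<and>
      bij_betw R {..<p} {S. extreme_ray n C S} \<and>
      (\<forall>i<p. v i \<in> carrier_vec n \<and> R i = ray (v i)) \<and>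
      \<sigma> permutes {..<p}
      \<longrightarrow> answers_within prog (input_state n p v \<sigma>) (K * (p ^ 3 * n)) (\<sigma> \<in> Proj n C p R)"
proof (intro exI allI impI)
  fix n p :: nat and C :: "real vec set" and R :: "nat \<Rightarrow> real vec set"
    and v :: "nat \<Rightarrow> real vec" and \<sigma> :: "nat \<Rightarrow> nat"
  assume "n \<ge> 1 \<and>
      polyhedral_cone n C \<and> full_dimensional n C \<and> pointed n C \<and> \<not> decomposable n C \<and>
      bij_betw R {..<p} {S. extreme_ray n C S} \<and>
      (\<forall>i<p. v i \<in> carrier_vec n \<and> R i = ray (v i)) \<and>
      \<sigma> permutes {..<p}"
  then interpret nondecomposable_cone n p C R v \<sigma> by unfold_locales auto
  \<comment> \<open>Unification fixes the witnesses here: the program \<open>decide\<close> and the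
    constant 2000, both independent of the cone, its dimension and the permutation.\<close>
  show "answers_within decide (input_state n p v \<sigma>) (2000 * (p ^ 3 * n)) (\<sigma> \<in> Proj n C p R)"
    by (rule decide_correct)
qed

end
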